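(* Let $q\ge 7$ be an odd prime power and let $R\ge 4$. Then for every integer $t$ with $t=2$ or $t\ge\lceil\log_q R\rceil+3$, setting $r=tR$, there exists an $[n,n-r,3]_qR,R$ locally optimal surface-covering code with \[ n=Rq^{(r-R)/R}+q^{(r-2R)/R}. \]
   Context: An $[n,n-r,d]_qR,R$ (surface-covering) code is a $q$-ary linear code of length $n$, codimension $r$, minimum distance $d$ and covering radius $R$ such that every column of $\mathbb{F}_q^r$ (including the zero column) is a linear combination with nonzero coefficients of exactly $R$ distinct columns of its parity check matrix. The covering radius is the least $R$ such that every column of $\mathbb{F}_q^r$ is a linear combination of at most $R$ columns of the parity check matrix. Locally optimal: no column of the parity check matrix can be removed without an increase in covering radius. *)

theory Defs
  imports
    Complex_Main
    "HOL-Library.Cardinality"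
    "HOL-Library.Extended_Nat"
    "HOL-Number_Theory.Prime_Powers"
    "Jordan_Normal_Form.Matrix_Kernel"
    "Jordan_Normal_Form.DL_Rank"
begin

definition linear_code :: "nat \<Rightarrow> nat \<Rightarrow> 'a :: field vec set \<Rightarrow> bool" where
  "linear_code n k C \<longleftrightarrow>
     subspace class_ring C (module_vec TYPE('a) n) \<and>
     vectorspace.dim class_ring ((module_vec TYPE('a) n)\<lparr>carrier := C\<rparr>) = k"

definition hamming_dist :: "'a vec \<Rightarrow> 'a vec \<Rightarrow> nat" where
  "hamming_dist x y = card {i. i < dim_vec x \<and> x $ i \<noteq> y $ i}"

text \<open>On \<open>nat\<close> one has \<open>Inf {} = 0\<close>, so a code without two distinct words gets the
  value 0; a positive value is always attained by a pair of distinct codewords.\<close>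

definition min_distance :: "'a vec set \<Rightarrow> nat" where
  "min_distance C = Inf {hamming_dist x y | x y. x \<in> C \<and> y \<in> C \<and> x \<noteq> y}"

text \<open>A parity check matrix of a code of codimension \<open>r\<close> has \<open>r\<close> linearly independent rows.\<close>

definition parity_check_matrix :: "nat \<Rightarrow> nat \<Rightarrow> 'a :: field vec set \<Rightarrow> 'a mat \<Rightarrow> bool" where
  "parity_check_matrix n r C H \<longleftrightarrow>
     H \<in> carrier_mat r n \<and> vec_space.rank r H = r \<and> C = mat_kernel H"

definition column_comb :: "'a :: field mat \<Rightarrow> (nat \<Rightarrow> 'a) \<Rightarrow> nat set \<Rightarrow> 'a vec" where
  "column_comb H a J = finsum_vec TYPE('a) (dim_row H) (\<lambda>j. a j \<cdot>\<^sub>v col H j) J"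

definition covers_within :: "'a :: field mat \<Rightarrow> nat \<Rightarrow> bool" where
  "covers_within H \<rho> \<longleftrightarrow>
     (\<forall>v \<in> carrier_vec (dim_row H). \<exists>J a. J \<subseteq> {..<dim_col H} \<and> card J \<le> \<rho> \<and>
        v = column_comb H a J)"

text \<open>The value is \<open>\<infinity>\<close> if the columns do not span the whole space, so that deleting a column
  whose absence destroys spanning counts as an increase of the covering radius.\<close>

definition covering_radius :: "'a :: field mat \<Rightarrow> enat" where
  "covering_radius H = Inf (enat ` {\<rho>. covers_within H \<rho>})"

text \<open>Distinct columns are columns at distinct positions; if the code with parity check matrix
  \<open>H\<close> has minimum distance at least 3, these are also distinct (non-proportional) as vectors.
  The zero vector is included among the \<open>v\<close>.\<close>

definition surface_covering :: "'a :: field mat \<Rightarrow> nat \<Rightarrow> bool" where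
  "surface_covering H R \<longleftrightarrow>
     (\<forall>v \<in> carrier_vec (dim_row H). \<exists>J a. J \<subseteq> {..<dim_col H} \<and> card J = R \<and>
        (\<forall>j\<in>J. a j \<noteq> 0) \<and> v = column_comb H a J)"

definition delete_column :: "'a mat \<Rightarrow> nat \<Rightarrow> 'a mat" where
  "delete_column H j =
     mat (dim_row H) (dim_col H - 1) (\<lambda>(i, k). H $$ (i, if k < j then k else Suc k))"

definition locally_optimal :: "'a :: field mat \<Rightarrow> bool" where
  "locally_optimal H \<longleftrightarrow>
     (\<forall>j < dim_col H. covering_radius H < covering_radius (delete_column H j))"

text \<open>\<open>C\<close> is an \<open>[n, n - r, d]\<^sub>q R, R\<close> code with parity check matrix \<open>H\<close>. The rank condition
  on \<open>H\<close> gives \<open>r \<le> n\<close>, so the subtraction is not truncated. Covering radius, surface covering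
  and local optimality do not depend on which parity check matrix of \<open>C\<close> is chosen.\<close>

definition surface_covering_code ::
  "nat \<Rightarrow> nat \<Rightarrow> nat \<Rightarrow> nat \<Rightarrow> 'a :: field vec set \<Rightarrow> 'a mat \<Rightarrow> bool" where
  "surface_covering_code n r d R C H \<longleftrightarrow>
     linear_code n (n - r) C \<and> min_distance C = d \<and>
     parity_check_matrix n r C H \<and> covering_radius H = enat R \<and> surface_covering H R"

end

theory Submission
  imports
    Defs
    "HOL-Number_Theory.Residues"
    "HOL-Algebra.Algebraic_Closure_Type"
begin

text \<open>
  The case \<open>t = 2\<close> is a chain of \<open>R\<close> curves with \<open>q\<close> points each and one extra point. With
  coordinates \<open>a i, p i\<close> (\<open>i < R\<close>), block \<open>i\<close> consists of the points
  \<open>a i = 1, p i = y, p (i - 1) = inverse y\<close>, and the extra point is \<open>p (R - 1) = 1\<close>. A vector with all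
  \<open>a i\<close> nonzero needs one column from every block, and solving for the parameters from the top
  of the chain down shows that these are unique; this gives the covering radius and local
  optimality. For an arbitrary vector one also proceeds down the chain, using that a block can produce
  almost every triple with two of its columns and every triple with three or four, so that
  the blocks which are skipped (\<open>a i = 0\<close>) can be balanced against those that use several columns.

  For larger \<open>t\<close> every base column \<open>h\<close> is replaced by the columns
  \<open>(h, x, \<beta> x, \<beta>\<^sup>2 x, \<dots>)\<close> with \<open>x\<close> in the field \<open>K\<close> of order \<open>q ^ (t - 2)\<close>, where the
  \<open>\<beta>\<close> are distinct elements of \<open>K \<union> {\<infinity>}\<close>. As every vector uses \<open>R\<close> distinct base columns with
  nonzero coefficients, the new coordinates are solved for by a Vandermonde system, and the lower
  bound on \<open>t\<close> says that \<open>K \<union> {\<infinity>}\<close> is large enough.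
\<close>

section \<open>Combinations inside one block\<close>

text \<open>The points (1, y, \<open>inverse y\<close>) form the plane curve behind one block;
  \<alpha> is the share of the block in its own coordinate \<open>p i\<close>, and \<beta> is the
  share that leaks into \<open>p (i - 1)\<close>. Counting the support of a total function enforces
  exactly \<open>k\<close> distinct columns.\<close>

definition block_comb :: "'a::{field,finite} \<Rightarrow> 'a \<Rightarrow> 'a \<Rightarrow> nat \<Rightarrow> bool" where
  "block_comb a \<alpha> \<beta> k \<longleftrightarrow> (\<exists>c. card {y. c y \<noteq> 0} = k \<and> (\<Sum>y\<in>UNIV. c y) = a \<and>
     (\<Sum>y\<in>UNIV. c y * y) = \<alpha> \<and> (\<Sum>y\<in>UNIV. c y * inverse y) = \<beta>)"

lemma ex_not_mem_if_card_less:
  fixes S :: "'a::finite set"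
  assumes "card S < CARD('a)"
  shows "\<exists>x. x \<notin> S"
  using assms by (metis UNIV_eq_I less_irrefl)

text \<open>The points with nonzero y, together with (0, 1, 0) and (0, 0, 1), form the conic X * X =
  Y * Z. A line through the given point off the conic and the point of parameter y meets the conic
  again in a usable point y', unless it is tangent or passes through one of the two points at
  infinity. With y = 0 this excludes at most five values of y.\<close>

lemma secant_avoiding_zero:
  fixes b \<alpha> \<beta> :: "'a::{field,finite}"
  assumes card: "CARD('a) \<ge> 7" and two: "(2::'a) \<noteq> 0"
    and b: "b \<noteq> 0" and off: "\<alpha> * \<beta> \<noteq> b * b"
  obtains y y' c c' where "y \<noteq> 0" "y' \<noteq> 0" "y \<noteq> y'" "c \<noteq> 0" "c' \<noteq> 0"
    "c + c' = b" "c * y + c' * y' = \<alpha>" "c * inverse y + c' * inverse y' = \<beta>"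
proof -
  \<comment> \<open>The roots are the parameters of tangency, where y' would coincide with
    y.\<close>
  let ?Z = "{y. poly [:\<alpha>, - 2 * b, \<beta>:] y = 0}"
  have nz: "[:\<alpha>, - 2 * b, \<beta>:] \<noteq> 0"
    using b two by simp
  have "card ?Z \<le> Polynomial.degree [:\<alpha>, - 2 * b, \<beta>:]" by (rule card_poly_roots_bound[OF nz])
  also have "\<dots> \<le> 2" by simp
  finally have "card ?Z \<le> 2" .
  moreover have "card ({0, b / \<beta>, \<alpha> / b} \<union> ?Z) \<le> card {0, b / \<beta>, \<alpha> / b} + card ?Z"
    by (rule card_Un_le)
  moreover have "card {0, b / \<beta>, \<alpha> / b} \<le> 3" by (simp add: card_insert_if)
  ultimately have "card ({0, b / \<beta>, \<alpha> / b} \<union> ?Z) < CARD('a)" using card by linarith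
  then obtain y where y: "y \<notin> {0, b / \<beta>, \<alpha> / b} \<union> ?Z"
    using ex_not_mem_if_card_less by blast
  have y0: "y \<noteq> 0" and "y \<noteq> \<alpha> / b" and q: "\<alpha> - 2 * b * y + \<beta> * y * y \<noteq> 0"
    using y by (auto simp: algebra_simps)
  then have ya: "b * y - \<alpha> \<noteq> 0" using b by (auto simp: field_simps)
  have yb: "\<beta> * y - b \<noteq> 0"
    using y b by (auto simp: field_simps)
  \<comment> \<open>Solved from the collinearity condition
    \<open>\<beta> * y * y' - b * (y + y') + \<alpha> = 0\<close>; \<open>c\<close> and
    \<open>c'\<close> below then come from the first two coordinates.\<close>
  define y' where "y' = (b * y - \<alpha>) / (\<beta> * y - b)"
  have y'0: "y' \<noteq> 0" using ya yb by (simp add: y'_def)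
  have e: "y' * (\<beta> * y - b) = b * y - \<alpha>" using yb by (simp add: y'_def)
  have ne: "y \<noteq> y'"
  proof
    assume "y = y'"
    then have "y * (\<beta> * y - b) = b * y - \<alpha>" using e by simp
    then show False using q by (simp add: algebra_simps)
  qed
  define c where "c = (\<alpha> - b * y') / (y - y')"
  define c' where "c' = (b * y - \<alpha>) / (y - y')"
  have d: "y - y' \<noteq> 0" using ne by simp
  have "\<alpha> - b * y' \<noteq> 0"
  proof
    assume "\<alpha> - b * y' = 0"
    then have a: "\<alpha> = b * y'" by simp
    then have "y' * (\<beta> * y) = b * y" using e by (simp add: algebra_simps)
    then have "y' * \<beta> = b" using y0 by simp
    then show False using off a by (simp add: algebra_simps)
  qed
  then have c0: "c \<noteq> 0" using d by (simp add: c_def)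
  have c'0: "c' \<noteq> 0" using d ya by (simp add: c'_def)
  have "c + c' = ((\<alpha> - b * y') + (b * y - \<alpha>)) / (y - y')"
    unfolding c_def c'_def by (rule add_divide_distrib[symmetric])
  also have "\<dots> = b" using d by (simp add: field_simps)
  finally have s0: "c + c' = b" .
  have "c * y + c' * y' = ((\<alpha> - b * y') * y + (b * y - \<alpha>) * y') / (y - y')"
    unfolding c_def c'_def by (simp add: add_divide_distrib)
  also have "\<dots> = \<alpha>" using d by (simp add: field_simps)
  finally have s1: "c * y + c' * y' = \<alpha>" .
  have "c * y' + c' * y = b * (y + y') - \<alpha>"
  proof -
    have "c * y' + c' * y = (c + c') * (y + y') - (c * y + c' * y')" by (simp add: algebra_simps)
    then show ?thesis using s0 s1 by simp
  qed
  also have "\<dots> = \<beta> * y * y'" using e by (simp add: algebra_simps)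
  finally have "c * y' + c' * y = \<beta> * y * y'" .
  then have s2: "c * inverse y + c' * inverse y' = \<beta>" using y0 y'0
    by (simp add: field_simps)
  show thesis by (rule that[OF y0 y'0 ne c0 c'0 s0 s1 s2])
qed

lemma block_combI:
  assumes "\<And>y. y \<in> A \<Longrightarrow> c y \<noteq> 0"
  shows "block_comb (\<Sum>y\<in>A. c y) (\<Sum>y\<in>A. c y * y) (\<Sum>y\<in>A. c y * inverse y) (card A)"
proof -
  let ?c = "\<lambda>y. if y \<in> A then c y else 0"
  have 1: "{y. ?c y \<noteq> 0} = A" using assms by auto
  have 2: "(\<Sum>y\<in>UNIV. ?c y * f y) = (\<Sum>y\<in>A. c y * f y)" for f
    by (rule sum.mono_neutral_cong_right) auto
  show ?thesis
    unfolding block_comb_def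
    by (rule exI[of _ ?c]) (use 1 2 2[of "\<lambda>_. 1"] in simp)
qed

lemma block_comb_0: "block_comb 0 0 0 0"
  using block_combI[of "{}"] by simp

lemma block_comb_1: "a \<noteq> 0 \<Longrightarrow> \<exists>\<beta>. block_comb a \<alpha> \<beta> 1"
  using block_combI[of "{\<alpha> / a}" "\<lambda>_. a"] by auto

lemma block_combI2:
  assumes "y1 \<noteq> y2" "c1 \<noteq> 0" "c2 \<noteq> 0"
  shows "block_comb (c1 + c2) (c1 * y1 + c2 * y2) (c1 * inverse y1 + c2 * inverse y2) 2"
proof -
  let ?c = "(\<lambda>_. 0)(y1 := c1, y2 := c2)"
  have "\<And>y. y \<in> {y1, y2} \<Longrightarrow> ?c y \<noteq> 0"
    using assms by auto
  from block_combI[of "{y1, y2}" ?c, OF this] show ?thesis using assms by (simp add: add.assoc numeral_eq_Suc)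
qed

lemma block_combI3:
  assumes "distinct [y1, y2, y3]" "c1 \<noteq> 0" "c2 \<noteq> 0" "c3 \<noteq> 0"
  shows "block_comb (c1 + c2 + c3) (c1 * y1 + c2 * y2 + c3 * y3)
    (c1 * inverse y1 + c2 * inverse y2 + c3 * inverse y3) 3"
proof -
  let ?c = "(\<lambda>_. 0)(y1 := c1, y2 := c2, y3 := c3)"
  have "\<And>y. y \<in> {y1, y2, y3} \<Longrightarrow> ?c y \<noteq> 0"
    using assms by auto
  from block_combI[of "{y1, y2, y3}" ?c, OF this] show ?thesis using assms by (simp add: add.assoc numeral_eq_Suc)
qed

lemma block_combI4:
  assumes "distinct [y1, y2, y3, y4]" "c1 \<noteq> 0" "c2 \<noteq> 0" "c3 \<noteq> 0" "c4 \<noteq> 0"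
  shows "block_comb (c1 + c2 + c3 + c4) (c1 * y1 + c2 * y2 + c3 * y3 + c4 * y4)
    (c1 * inverse y1 + c2 * inverse y2 + c3 * inverse y3 + c4 * inverse y4) 4"
proof -
  let ?c = "(\<lambda>_. 0)(y1 := c1, y2 := c2, y3 := c3, y4 := c4)"
  have "\<And>y. y \<in> {y1, y2, y3, y4} \<Longrightarrow> ?c y \<noteq> 0"
    using assms by auto
  from block_combI[of "{y1, y2, y3, y4}" ?c, OF this] show ?thesis using assms by (simp add: add.assoc numeral_eq_Suc)
qed

text \<open>For nonzero \<open>a\<close> the point either lies off the conic and on a secant, or
  lies on it and is written with the centre, the point of parameter 0. For \<open>a = 0\<close> the
  two coefficients are opposite, and as \<open>inverse\<close> is injective both other coordinates
  come out nonzero, which explains the hypothesis.\<close>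

lemma block_comb_2:
  fixes a \<alpha> \<beta> :: "'a::{field,finite}"
  assumes card: "CARD('a) \<ge> 7" and two: "(2::'a) \<noteq> 0"
    and "a \<noteq> 0 \<or> \<alpha> \<noteq> 0 \<and> \<beta> \<noteq> 0"
  shows "block_comb a \<alpha> \<beta> 2"
proof -
  consider "a \<noteq> 0" "\<alpha> * \<beta> \<noteq> a * a" | "a \<noteq> 0" "\<alpha> * \<beta> = a * a" | "a = 0" "\<alpha> \<noteq> 0" "\<beta> \<noteq> 0"
    using assms(3) by blast
  then show ?thesis
  proof cases
    case 1
    obtain y y' c c' where *: "y \<noteq> 0" "y' \<noteq> 0" "y \<noteq> y'" "c \<noteq> 0" "c' \<noteq> 0"
      "c + c' = a" "c * y + c' * y' = \<alpha>" "c * inverse y + c' * inverse y' = \<beta>"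
      by (rule secant_avoiding_zero[OF card two 1])
    show ?thesis using block_combI2[OF *(3-5)] unfolding *(6-8) .
  next
    case 2
    \<comment> \<open>On the curve: the points with parameters \<open>y\<close>, \<open>0\<close> and \<open>-y\<close> are collinear, since \<open>inverse\<close>
      is odd and maps \<open>0\<close> to \<open>0\<close>.\<close>
    have a0: "\<alpha> \<noteq> 0" using 2 by auto
    have "block_comb (2 * a + - a) (2 * a * 0 + - a * (- (\<alpha> / a)))
        (2 * a * inverse 0 + - a * inverse (- (\<alpha> / a))) 2"
      by (rule block_combI2) (use 2 two a0 in auto)
    moreover have "- a * inverse (- (\<alpha> / a)) = \<beta>" using 2 a0 by (simp add: field_simps)
    ultimately show ?thesis using 2 by simp
  next
    case 3
    \<comment> \<open>With coefficients c and -c the ratio of the other two coordinates forces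
      \<open>y * y' = - \<alpha> / \<beta>\<close>; the quadratic excludes y' = y.\<close>
    let ?Z = "{y. poly [:\<alpha> / \<beta>, 0, 1:] y = 0}"
    have "card ?Z \<le> Polynomial.degree [:\<alpha> / \<beta>, 0, 1:]" by (rule card_poly_roots_bound) simp
    also have "\<dots> \<le> 2" by simp
    finally have "card (insert 0 ?Z) < CARD('a)" using card by (simp add: card_insert_if)
    then obtain y where y: "y \<notin> insert 0 ?Z"
      using ex_not_mem_if_card_less by blast
    then have y0: "y \<noteq> 0" and "\<alpha> / \<beta> + y * y \<noteq> 0" by auto
    then have yn: "\<alpha> + \<beta> * (y * y) \<noteq> 0" using 3 by (simp add: field_simps)
    define y' where "y' = - \<alpha> / (\<beta> * y)"
    have y'0: "y' \<noteq> 0" using 3 y0 by (simp add: y'_def)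
    have e: "\<beta> * (y * y') = - \<alpha>" using 3 y0 by (simp add: y'_def)
    have d: "y - y' \<noteq> 0"
    proof
      assume "y - y' = 0"
      then have "\<alpha> + \<beta> * (y * y) = 0" using e by simp
      then show False using yn by simp
    qed
    define c where "c = \<alpha> / (y - y')"
    have c0: "c \<noteq> 0" and cd: "c * (y - y') = \<alpha>" using d 3 by (simp_all add: c_def)
    then have s1: "c * y + - c * y' = \<alpha>" by (simp add: algebra_simps)
    have "c * inverse y + - c * inverse y' = - (c * (y - y')) / (y * y')"
      using y0 y'0 by (simp add: field_simps)
    also have "\<dots> = - \<alpha> / (y * y')" using cd by simp
    also have "\<dots> = \<beta>" using e y0 y'0 by (simp add: field_simps)
    finally have s2: "c * inverse y + - c * inverse y' = \<beta>" .
    show ?thesis using block_combI2[of y y' c "- c"] d c0 3 s1 s2 by simp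
  qed
qed

text \<open>The column with y = 0 is the centre (1, 0, 0) and changes only the first coordinate. It
  supplies \<open>a - b\<close>, where \<open>b\<close> is chosen so that (b, \<alpha>, \<beta>)
  lies off the conic and the third coefficient does not vanish.\<close>

lemma block_comb_3:
  fixes a \<alpha> \<beta> :: "'a::{field,finite}"
  assumes card: "CARD('a) \<ge> 7" and two: "(2::'a) \<noteq> 0"
  shows "block_comb a \<alpha> \<beta> 3"
proof -
  let ?Z = "{y. poly [:- (\<alpha> * \<beta>), 0, 1:] y = 0}"
  have "card ?Z \<le> Polynomial.degree [:- (\<alpha> * \<beta>), 0, 1:]" by (rule card_poly_roots_bound) simp
  also have "\<dots> \<le> 2" by simp
  finally have "card (insert 0 (insert a ?Z)) < CARD('a)" using card by (simp add: card_insert_if)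
  then obtain b where b: "b \<notin> insert 0 (insert a ?Z)"
    using ex_not_mem_if_card_less by blast
  then have b0: "b \<noteq> 0" "b \<noteq> a" and off: "\<alpha> * \<beta> \<noteq> b * b" by auto
  obtain y y' c c' where *: "y \<noteq> 0" "y' \<noteq> 0" "y \<noteq> y'" "c \<noteq> 0" "c' \<noteq> 0"
    "c + c' = b" "c * y + c' * y' = \<alpha>" "c * inverse y + c' * inverse y' = \<beta>"
    by (rule secant_avoiding_zero[OF card two b0(1) off])
  have "block_comb (c + c' + (a - b)) (c * y + c' * y' + (a - b) * 0)
      (c * inverse y + c' * inverse y' + (a - b) * inverse 0) 3"
    by (rule block_combI3) (use * b0 in auto)
  then show ?thesis unfolding *(6-8) by simp
qed

text \<open>On the parameters 1, -1, t, -t, oddness of y and \<open>inverse y\<close> makes \<alpha>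
  and \<beta> depend only on the coefficient differences \<open>d\<close> and \<open>e\<close> of
  the two pairs. The sums of the pairs, \<open>s\<close> and \<open>a - s\<close>, leave one free
  parameter for making all four coefficients nonzero.\<close>

lemma block_comb_4:
  fixes a \<alpha> \<beta> :: "'a::{field,finite}"
  assumes card: "CARD('a) \<ge> 7" and two: "(2::'a) \<noteq> 0"
  shows "block_comb a \<alpha> \<beta> 4"
proof -
  have m1: "(1::'a) \<noteq> - 1"
  proof
    assume "(1::'a) = - 1"
    then have "(1::'a) + 1 = 0" by (metis add.right_inverse)
    then show False using two by simp
  qed
  have "card {0, 1, - 1 :: 'a} < CARD('a)" using card by (simp add: card_insert_if)
  then obtain t where t: "t \<notin> {0, 1, - 1 :: 'a}" using ex_not_mem_if_card_less by blast
  then have t0: "t \<noteq> 0" "t \<noteq> 1" "t \<noteq> - 1" by auto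
  have dt: "t - inverse t \<noteq> 0"
  proof
    assume "t - inverse t = 0"
    then have "t * t = 1" using t0 by (simp add: field_simps)
    then show False using t0 by (simp add: square_eq_1_iff)
  qed
  have tt: "t \<noteq> - t"
  proof
    assume "t = - t"
    then have "2 * t = 0" by (metis add.right_inverse mult_2)
    then show False using two t0 by simp
  qed
  define e where "e = (\<alpha> - \<beta>) / (t - inverse t)"
  define d where "d = \<alpha> - e * t"
  have e1: "d + e * t = \<alpha>" by (simp add: d_def)
  have "e * (t - inverse t) = \<alpha> - \<beta>" using dt by (simp add: e_def)
  then have e2: "d + e * inverse t = \<beta>" by (simp add: d_def algebra_simps)
  have "card {d, - d, a - e, a + e} < CARD('a)" using card
    by (simp add: card_insert_if)
  then obtain s where s: "s \<notin> {d, - d, a - e, a + e}" using ex_not_mem_if_card_less by blast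
  have "s + d \<noteq> 0" using s by (metis eq_neg_iff_add_eq_0 insertCI)
  moreover have "s - d \<noteq> 0" using s by simp
  moreover have "a - s + e \<noteq> 0"
  proof
    assume "a - s + e = 0"
    then have "s = a + e" by (simp add: algebra_simps)
    then show False using s by simp
  qed
  moreover have "a - s - e \<noteq> 0"
  proof
    assume "a - s - e = 0"
    then have "s = a - e" by (simp add: algebra_simps)
    then show False using s by simp
  qed
  ultimately have nz: "(s + d) / 2 \<noteq> 0" "(s - d) / 2 \<noteq> 0" "(a - s + e) / 2 \<noteq> 0"
    "(a - s - e) / 2 \<noteq> 0" using two by simp_all
  have "t \<noteq> 0" "distinct [1, - 1, t, - t]" using t0 tt m1 by (auto simp: minus_equation_iff)
  have half: "(x + y) / 2 + (x - y) / 2 = x" "(x + y) / 2 - (x - y) / 2 = y" for x y :: 'a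
    using two by (simp_all flip: add_divide_distrib diff_divide_distrib)
  have "block_comb ((s + d) / 2 + (s - d) / 2 + (a - s + e) / 2 + (a - s - e) / 2)
     ((s + d) / 2 * 1 + (s - d) / 2 * (- 1) + (a - s + e) / 2 * t + (a - s - e) / 2 * (- t))
     ((s + d) / 2 * inverse 1 + (s - d) / 2 * inverse (- 1) + (a - s + e) / 2 * inverse t
       + (a - s - e) / 2 * inverse (- t)) 4"
    by (rule block_combI4[OF _ nz]) fact
  moreover have "(s + d) / 2 + (s - d) / 2 + (a - s + e) / 2 + (a - s - e) / 2 = a"
    using half(1)[of s d] half(1)[of "a - s" e] by (simp add: add.assoc)
  moreover have "(s + d) / 2 * 1 + (s - d) / 2 * (- 1) + (a - s + e) / 2 * x
      + (a - s - e) / 2 * (- x) = d + e * x" for x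
  proof -
    have "(s + d) / 2 * 1 + (s - d) / 2 * (- 1) + (a - s + e) / 2 * x + (a - s - e) / 2 * (- x)
        = ((s + d) / 2 - (s - d) / 2) + ((a - s + e) / 2 - (a - s - e) / 2) * x"
      by (simp add: left_diff_distrib)
    then show ?thesis unfolding half .
  qed
  ultimately show ?thesis using e1 e2 by simp
qed

section \<open>Column counts along the chain of blocks\<close>

text \<open>Blocks are processed from the top down. \<open>r\<close> is what block \<open>m - 1\<close> has to contribute to the
  coordinate \<open>p (m - 1)\<close>, and \<open>\<beta>\<close> is what block \<open>m\<close> leaks into it; \<open>N\<close> counts the
  columns spent. The last contribution, of block \<open>0\<close> to a coordinate below it, is discarded, since
  \<open>reach a p 0\<close> ignores \<open>r\<close> (so the junk value \<open>p (0 - 1)\<close> is harmless).\<close>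

primrec reach :: "(nat \<Rightarrow> 'a::{field,finite}) \<Rightarrow> (nat \<Rightarrow> 'a) \<Rightarrow> nat \<Rightarrow> 'a \<Rightarrow> nat \<Rightarrow> bool" where
  "reach a p 0 r N \<longleftrightarrow> N = 0"
| "reach a p (Suc m) r N \<longleftrightarrow>
     (\<exists>\<beta> k N'. block_comb (a m) r \<beta> k \<and> reach a p m (p (m - 1) - \<beta>) N' \<and> N = k + N')"

lemma reachI:
  assumes "block_comb (a m) r (p (m - 1) - s) k" "reach a p m s N'" "N = k + N'"
  shows "reach a p (Suc m) r N"
  unfolding reach.simps
  by (rule exI[of _ "p (m - 1) - s"], rule exI[of _ k], rule exI[of _ N']) (use assms in simp)

declare reach.simps(2) [simp del]

context
  fixes a p :: "nat \<Rightarrow> 'a::{field,finite}"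
  assumes card: "CARD('a) \<ge> 7" and two: "(2::'a) \<noteq> 0"
begin

lemma reach_0:
  assumes "a m = 0" "reach a p m (p (m - 1)) N"
  shows "reach a p (Suc m) 0 N"
  by (rule reachI[of _ _ _ _ "p (m - 1)" 0]) (use assms block_comb_0 in auto)

text \<open>A single column has parameter \<open>r / a m\<close>, so its leak cannot be chosen. The
  resulting requirement \<open>s\<close> is independent of the count, hence the order of the
  quantifiers.\<close>

lemma reach_1:
  assumes "a m \<noteq> 0"
  shows "\<exists>s. \<forall>N. reach a p m s N \<longrightarrow> reach a p (Suc m) r (1 + N)"
proof -
  obtain \<beta> where "block_comb (a m) r \<beta> 1" using block_comb_1[OF assms] by blast
  then have "reach a p m (p (m - 1) - \<beta>) N \<Longrightarrow> reach a p (Suc m) r (1 + N)" for N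
    by (intro reachI[of _ _ _ _ "p (m - 1) - \<beta>"]) auto
  then show ?thesis by blast
qed

text \<open>The leak is now free, so the requirement \<open>s\<close> on the block below is chosen
  first and the leak is set to \<open>p (m - 1) - s\<close>. For \<open>a m = 0\<close> two columns
  need this leak to be nonzero.\<close>

lemma reach_2:
  assumes "a m \<noteq> 0 \<or> r \<noteq> 0 \<and> s \<noteq> p (m - 1)" "reach a p m s N'" "N = 2 + N'"
  shows "reach a p (Suc m) r N"
  by (rule reachI[OF block_comb_2[OF card two] assms(2,3)]) (use assms(1) in auto)

lemma reach_3:
  assumes "reach a p m s N'" "N = 3 + N'"
  shows "reach a p (Suc m) r N"
  by (rule reachI[OF block_comb_3[OF card two] assms])

lemma reach_4:
  assumes "reach a p m s N'" "N = 4 + N'"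
  shows "reach a p (Suc m) r N"
  by (rule reachI[OF block_comb_4[OF card two] assms])

text \<open>The target is one column per block, i.e. \<open>N = m\<close>. A block with \<open>a m = 0\<close> costs no column
  if nothing is required of it and two columns otherwise, which is where the alternative between
  \<open>tight\<close> and \<open>semitight\<close> comes from; the slack upwards is used to absorb accidental savings.\<close>

definition tight :: "nat \<Rightarrow> bool" where
  "tight m \<longleftrightarrow> (\<forall>r. reach a p m r m \<and> reach a p m r (m + 1) \<and> reach a p m r (m + 2))"

definition semitight :: "nat \<Rightarrow> bool" where
  "semitight m \<longleftrightarrow> m > 0 \<and> (\<exists>r0. reach a p m r0 (m - 1) \<and> reach a p m r0 m \<and> reach a p m r0 (m + 1) \<and>
     (\<forall>r. r \<noteq> r0 \<longrightarrow> reach a p m r (m + 1) \<and> reach a p m r (m + 2)))"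

text \<open>For \<open>a m = 0\<close> the requirement 0 is met by skipping the block and becomes
  the exceptional value \<open>r0\<close>, while any other costs two columns. Otherwise one column
  in this block suffices for every requirement.\<close>

lemma tight_Suc: "tight m \<Longrightarrow> tight (Suc m) \<or> semitight (Suc m)"
proof (cases "a m = 0")
  case True
  assume t: "tight m"
  have "semitight (Suc m)"
    unfolding semitight_def
  proof (intro conjI exI[of _ 0] allI impI)
    fix r :: 'a assume r: "r \<noteq> 0"
    \<comment> \<open>Asking for one more than \<open>p (m - 1)\<close> makes the leak -1, hence
      nonzero.\<close>
    have s: "a m \<noteq> 0 \<or> r \<noteq> 0 \<and> p (m - 1) + 1 \<noteq> p (m - 1)" using r by simp
    have "reach a p m (p (m - 1) + 1) N" if "N \<in> {m, m + 1}" for N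
      using t that unfolding tight_def by blast
    from reach_2[OF s this[of m]] reach_2[OF s this[of "m + 1"]]
    show "reach a p (Suc m) r (Suc m + 1)" "reach a p (Suc m) r (Suc m + 2)"
      by (simp_all add: numeral_eq_Suc)
  qed (use t True in \<open>auto simp: tight_def intro!: reach_0\<close>)
  then show ?thesis ..
next
  case False
  assume t: "tight m"
  have "reach a p (Suc m) r (1 + N)" if "N \<in> {m, m + 1, m + 2}" for r N
    using reach_1[OF False, of r] t that unfolding tight_def by blast
  then have "tight (Suc m)" unfolding tight_def by auto
  then show ?thesis ..
qed

text \<open>Two columns can steer the block below to its cheap requirement \<open>r0\<close>, which
  pays for the second column. This can fail only if \<open>a m = 0\<close> and moreover
  \<open>r = 0\<close> or \<open>r0 = p (m - 1)\<close>; then skipping the block or spending three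
  columns gives the counts, and only \<open>r0 = p (m - 1)\<close> leaves 0 as an exceptional
  requirement.\<close>

lemma semitight_Suc: "semitight m \<Longrightarrow> tight (Suc m) \<or> semitight (Suc m)"
proof -
  assume "semitight m"
  then obtain r0 where m: "m > 0"
    and r0: "reach a p m r0 (m - 1)" "reach a p m r0 m" "reach a p m r0 (m + 1)"
    and r1: "\<And>r. r \<noteq> r0 \<Longrightarrow> reach a p m r (m + 1)" "\<And>r. r \<noteq> r0 \<Longrightarrow> reach a p m r (m + 2)"
    unfolding semitight_def by blast
  have two_cols: "reach a p (Suc m) r (Suc m)" "reach a p (Suc m) r (Suc m + 1)"
    "reach a p (Suc m) r (Suc m + 2)" if "a m \<noteq> 0 \<or> r \<noteq> 0 \<and> r0 \<noteq> p (m - 1)" for r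
    using reach_2[OF that r0(1)] reach_2[OF that r0(2)] reach_2[OF that r0(3)] m by auto
  have three_cols: "reach a p (Suc m) r (Suc m + 1)" "reach a p (Suc m) r (Suc m + 2)" for r
    using reach_3[OF r0(1)] reach_3[OF r0(2)] m by (auto simp: numeral_eq_Suc)
  show ?thesis
  proof (cases "a m = 0")
    case True
    show ?thesis
    proof (cases "p (m - 1) = r0")
      case eq: True
      have "semitight (Suc m)"
        unfolding semitight_def using three_cols reach_0[OF True] r0 eq
        by (intro conjI exI[of _ 0] allI impI) auto
      then show ?thesis ..
    next
      case False
      have "tight (Suc m)"
        unfolding tight_def
      proof
        fix r
        show "reach a p (Suc m) r (Suc m) \<and> reach a p (Suc m) r (Suc m + 1) \<and>
            reach a p (Suc m) r (Suc m + 2)"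
          using two_cols[of r] False reach_0[OF True] r1[OF False] three_cols[of r]
          by (cases "r = 0") auto
      qed
      then show ?thesis ..
    qed
  next
    case False
    then have "tight (Suc m)" unfolding tight_def using two_cols by blast
    then show ?thesis ..
  qed
qed

lemma tight_or_semitight_mono:
  assumes "tight m \<or> semitight m" "m \<le> n"
  shows "tight n \<or> semitight n"
  using assms(2,1) by (induction rule: dec_induct) (blast dest: tight_Suc semitight_Suc)+

text \<open>If the lowest blocks require nothing at all, the counts \<open>1\<close> and \<open>2\<close> are unreachable, so the
  alternative only holds from three blocks on.\<close>

lemma tight_or_semitight_3: "tight 3 \<or> semitight 3"
proof (cases "a 0 = 0")
  case False
  have "reach a p (Suc 0) r 1" "reach a p (Suc 0) r 2" "reach a p (Suc 0) r 3" for r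
    using reach_1[OF False, of r] reach_2[of 0 r 0 0] reach_3[of 0 0 0] False by auto
  then have "tight 1" unfolding tight_def by (auto simp: numeral_eq_Suc)
  then show ?thesis using tight_or_semitight_mono[of 1 3] by simp
next
  case a0: True
  have z: "reach a p 0 s 0" for s by simp
  \<comment> \<open>The leak of block 0 is discarded; \<open>p 0 + 1\<close> serves as
    \<open>s\<close> because \<open>p (0 - 1)\<close> is read as \<open>p 0\<close>.\<close>
  have A1: "reach a p 1 0 0" "reach a p 1 r 3" "reach a p 1 r 4"  "r \<noteq> 0 \<Longrightarrow> reach a p 1 r 2" for r
    using reach_0[OF a0 z] reach_3[OF z] reach_4[OF z]
      reach_2[of 0 r "p 0 + 1" 0] by (auto)
  have A2: "reach a p 2 r 3" "reach a p 2 r 4" for r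
    using reach_3[of 1 0 0] reach_4[of 1 0 0] A1(1) by (auto simp: numeral_2_eq_2)
  have A2': "reach a p 2 r 5" for r
    using reach_3[of 1 1 2] A1(4)[of 1] by (auto simp: numeral_2_eq_2)
  show ?thesis
  proof (cases "a 1 = 0 \<and> p 0 = 0")
    case True
    \<comment> \<open>Blocks 0 and 1 can be left empty, so block 2 supplies three or four columns
      alone; the count 5 is reached with columns spent further down.\<close>
    have "tight 3"
      unfolding tight_def
    proof
      fix r
      have "reach a p 2 0 0"
        using reach_0[of 1 0] True A1(1) by (simp add: numeral_2_eq_2)
      then have 34: "reach a p 3 r 3" "reach a p 3 r 4"
        using reach_3[of 2 0 0 3] reach_4[of 2 0 0 4] by (auto simp: numeral_3_eq_3 numeral_2_eq_2)
      have "reach a p 3 r 5"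
      proof (cases "a 2 = 0 \<and> r = 0")
        case True
        then show ?thesis using reach_0[of 2 5] A2'[of "p 1"] by (simp add: numeral_3_eq_3 numeral_2_eq_2)
      next
        case False
        have "p 1 + 1 \<noteq> p 1" by simp
        then show ?thesis using reach_2[of 2 r "p 1 + 1" 3 5] False A2(1)[of "p 1 + 1"]
          by (auto simp: numeral_3_eq_3 numeral_2_eq_2)
      qed
      then show "reach a p 3 r 3 \<and> reach a p 3 r (3 + 1) \<and> reach a p 3 r (3 + 2)"
        using 34 by simp
    qed
    then show ?thesis ..
  next
    case False
    have "tight 2"
      unfolding tight_def
    proof
      fix r
      have "reach a p 2 r 2"
      proof (cases "a 1 \<noteq> 0 \<or> r \<noteq> 0 \<and> 0 \<noteq> p (1 - 1)")
        case True
        then show ?thesis using reach_2[of 1 r 0 0 2] A1(1) by (simp add: numeral_2_eq_2)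
      next
        case *: False
        then have "r = 0" "a 1 = 0" "p 0 \<noteq> 0" using False by auto
        then show ?thesis using reach_0[of 1 2] A1(4)[of "p 0"] by (simp add: numeral_2_eq_2)
      qed
      then show "reach a p 2 r 2 \<and> reach a p 2 r (2 + 1) \<and> reach a p 2 r (2 + 2)"
        using A2[of r] by simp
    qed
    then show ?thesis using tight_or_semitight_mono[of 2 3] by simp
  qed
qed

text \<open>The extra column with coefficient \<tau> shifts the top requirement at the price of one
  column. In the semitight case it moves the requirement to \<open>r0\<close>, where
  \<open>R - 1\<close> columns suffice, unless \<open>p (R - 1)\<close> already equals
  \<open>r0\<close>.\<close>

lemma reach_final:
  assumes "R \<ge> 3"
  shows "\<exists>\<tau> N. reach a p R (p (R - 1) - \<tau>) N \<and> N + (if \<tau> = 0 then 0 else 1) = R"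
proof -
  consider "tight R" | "semitight R"
    using tight_or_semitight_mono[OF tight_or_semitight_3 assms] by blast
  then show ?thesis
  proof cases
    case 1
    then show ?thesis unfolding tight_def by (intro exI[of _ 0] exI[of _ R]) auto
  next
    case 2
    then obtain r0 where "reach a p R r0 (R - 1)" "reach a p R r0 R"
      unfolding semitight_def by blast
    then show ?thesis
    proof (cases "p (R - 1) = r0")
      case True
      then show ?thesis using \<open>reach a p R r0 R\<close> by (intro exI[of _ 0] exI[of _ R]) simp
    next
      case False
      then show ?thesis using \<open>reach a p R r0 (R - 1)\<close> assms
        by (intro exI[of _ "p (R - 1) - r0"] exI[of _ "R - 1"]) simp
    qed
  qed
qed

end

lemma reach_imp_coefficients:
  assumes "reach a p m r N"
  shows "\<exists>x. (\<forall>i<m. (\<Sum>y\<in>UNIV. x i y) = a i) \<and>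
    (\<forall>i. Suc i < m \<longrightarrow> (\<Sum>y\<in>UNIV. x i y * y) + (\<Sum>y\<in>UNIV. x (Suc i) y * inverse y) = p i) \<and>
    (m > 0 \<longrightarrow> (\<Sum>y\<in>UNIV. x (m - 1) y * y) = r) \<and>
    (\<Sum>i<m. card {y. x i y \<noteq> 0}) = N"
  using assms
proof (induction m arbitrary: r N)
  case 0
  then show ?case by simp
next
  case (Suc m)
  obtain \<beta> k N' where 1: "block_comb (a m) r \<beta> k" and 2: "reach a p m (p (m - 1) - \<beta>) N'"
    and N: "N = k + N'" using Suc.prems by (auto simp: reach.simps(2))
  obtain c where c: "card {y. c y \<noteq> 0} = k" "(\<Sum>y\<in>UNIV. c y) = a m"
    "(\<Sum>y\<in>UNIV. c y * y) = r" "(\<Sum>y\<in>UNIV. c y * inverse y) = \<beta>"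
    using 1 unfolding block_comb_def by blast
  obtain x where x: "\<forall>i<m. (\<Sum>y\<in>UNIV. x i y) = a i"
    "\<forall>i. Suc i < m \<longrightarrow> (\<Sum>y\<in>UNIV. x i y * y) + (\<Sum>y\<in>UNIV. x (Suc i) y * inverse y) = p i"
    "m > 0 \<longrightarrow> (\<Sum>y\<in>UNIV. x (m - 1) y * y) = p (m - 1) - \<beta>"
    "(\<Sum>i<m. card {y. x i y \<noteq> 0}) = N'"
    using Suc.IH[OF 2] by blast
  have "(\<Sum>y\<in>UNIV. (x(m := c)) i y * y) + (\<Sum>y\<in>UNIV. (x(m := c)) (Suc i) y * inverse y) = p i"
    if "Suc i < Suc m" for i
  proof (cases "Suc i = m")
    case True
    then have "i = m - 1" "i \<noteq> m" "m > 0" by auto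
    then show ?thesis using True c(4) x(3) by simp
  next
    case False
    then show ?thesis using that x(2) by simp
  qed
  then show ?case
    by (intro exI[of _ "x(m := c)"]) (use c x N in \<open>auto simp: less_Suc_eq\<close>)
qed

section \<open>Covering systems and the base code\<close>

definition weight :: "'c set \<Rightarrow> ('c \<Rightarrow> 'a::zero) \<Rightarrow> nat" where
  "weight C f = card {c \<in> C. f c \<noteq> 0}"

definition syndrome :: "('i \<Rightarrow> 'c \<Rightarrow> 'a::comm_ring) \<Rightarrow> 'c set \<Rightarrow> ('c \<Rightarrow> 'a) \<Rightarrow> 'i \<Rightarrow> 'a" where
  "syndrome M C f i = (\<Sum>c\<in>C. f c * M i c)"

text \<open>The second clause asks for a word through \<open>c\<close> that is the only one of weight at most \<open>R\<close> with
  its syndrome. This gives the lower bound on the covering radius and local optimality at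
  once, and unlike these two properties it is inherited by the lifted code.\<close>

definition covering_system :: "'i set \<Rightarrow> 'c set \<Rightarrow> ('i \<Rightarrow> 'c \<Rightarrow> 'a::comm_ring) \<Rightarrow> nat \<Rightarrow> bool" where
  "covering_system I C M R \<longleftrightarrow>
     (\<forall>v. \<exists>f. weight C f = R \<and> (\<forall>i\<in>I. syndrome M C f i = v i)) \<and>
     (\<forall>c\<in>C. \<exists>f0. weight C f0 = R \<and> f0 c \<noteq> 0 \<and>
        (\<forall>f. weight C f \<le> R \<longrightarrow> (\<forall>i\<in>I. syndrome M C f i = syndrome M C f0 i) \<longrightarrow>
           (\<forall>d\<in>C. f d = f0 d))) \<and>
     (\<forall>f. (\<forall>i\<in>I. syndrome M C f i = 0) \<longrightarrow> (\<exists>c\<in>C. f c \<noteq> 0) \<longrightarrow> weight C f \<ge> 3) \<and>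
     (\<exists>f. (\<forall>i\<in>I. syndrome M C f i = 0) \<and> weight C f = 3)"

text \<open>Rows \<open>(i, False)\<close> and \<open>(i, True)\<close> stand for the coordinates \<open>a i\<close> and \<open>p i\<close>. The column
  \<open>None\<close> is the extra point at the end of the chain, without which block \<open>R - 1\<close> could not be
  skipped. The graph of \<open>inverse\<close> (with \<open>inverse 0 = 0\<close>) plays the role of an oval: it is a hyperbola
  together with its centre.\<close>

definition base_columns :: "nat \<Rightarrow> (nat \<times> 'a::{field,finite}) option set" where
  "base_columns R = insert None (Some ` ({..<R} \<times> UNIV))"

fun base_entry :: "nat \<Rightarrow> nat \<times> bool \<Rightarrow> (nat \<times> 'a::{field,finite}) option \<Rightarrow> 'a" where
  "base_entry R (i, b) None = (if b \<and> Suc i = R then 1 else 0)"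
| "base_entry R (i, False) (Some (j, y)) = (if j = i then 1 else 0)"
| "base_entry R (i, True) (Some (j, y)) =
     (if j = i then y else if j = Suc i then inverse y else 0)"

lemma finite_base_columns [simp]: "finite (base_columns R)"
  by (simp add: base_columns_def)

lemma card_base_columns: "card (base_columns R :: (nat \<times> 'a::{field,finite}) option set) = R * CARD('a) + 1"
  unfolding base_columns_def
  by (subst card_insert_disjoint) (auto simp: card_image card_cartesian_product)

lemma sum_base_columns:
  "(\<Sum>c\<in>base_columns R. g c) = g None + (\<Sum>i<R. \<Sum>y\<in>UNIV. g (Some (i, y)))"
  unfolding base_columns_def
  by (subst sum.insert) (auto simp: sum.reindex sum.cartesian_product)

lemma weight_base_columns:
  fixes f :: "(nat \<times> 'a::{field,finite}) option \<Rightarrow> 'a"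
  shows "weight (base_columns R) f = (if f None = 0 then 0 else 1) +
    (\<Sum>i<R. card {y. f (Some (i, y)) \<noteq> 0})"
proof -
  have "weight (base_columns R) f = (\<Sum>c\<in>base_columns R. if f c \<noteq> 0 then 1 else 0)"
    unfolding weight_def by (simp add: sum.If_cases Int_def)
  then show ?thesis unfolding sum_base_columns by (simp add: sum.If_cases)
qed

lemma syndrome_base_False:
  assumes "i < R"
  shows "syndrome (base_entry R) (base_columns R) f (i, False) = (\<Sum>y\<in>UNIV. f (Some (i, y)))"
proof -
  have "(\<Sum>j<R. \<Sum>y\<in>UNIV. f (Some (j, y)) * base_entry R (i, False) (Some (j, y))) =
      (\<Sum>j<R. if j = i then \<Sum>y\<in>UNIV. f (Some (j, y)) else 0)"
    by (rule sum.cong) auto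
  then show ?thesis unfolding syndrome_def sum_base_columns using assms by simp
qed

lemma syndrome_base_True:
  assumes "i < R"
  shows "syndrome (base_entry R) (base_columns R) f (i, True) =
    (\<Sum>y\<in>UNIV. f (Some (i, y)) * y) +
    (if Suc i < R then \<Sum>y\<in>UNIV. f (Some (Suc i, y)) * inverse y else f None)"
proof -
  have "(\<Sum>j<R. \<Sum>y\<in>UNIV. f (Some (j, y)) * base_entry R (i, True) (Some (j, y))) =
      (\<Sum>j<R. (if j = i then \<Sum>y\<in>UNIV. f (Some (j, y)) * y else 0) +
        (if j = Suc i then \<Sum>y\<in>UNIV. f (Some (j, y)) * inverse y else 0))"
    by (rule sum.cong) auto
  then show ?thesis unfolding syndrome_def sum_base_columns using assms
    by (auto simp: sum.distrib)
qed

section \<open>The base code: surface covering, unique representations, minimum distance\<close>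

lemma base_surface_covering:
  fixes v :: "nat \<times> bool \<Rightarrow> 'a::{field,finite}"
  assumes card: "CARD('a) \<ge> 7" and two: "(2::'a) \<noteq> 0" and R: "R \<ge> 3"
  shows "\<exists>f. weight (base_columns R) f = R \<and>
    (\<forall>i\<in>{..<R} \<times> UNIV. syndrome (base_entry R) (base_columns R) f i = v i)"
proof -
  define a where "a i = v (i, False)" for i
  define p where "p i = v (i, True)" for i
  obtain \<tau> N where N: "reach a p R (p (R - 1) - \<tau>) N" "N + (if \<tau> = 0 then 0 else 1) = R"
    using reach_final[OF card two R] by blast
  obtain x where x: "\<forall>i<R. (\<Sum>y\<in>UNIV. x i y) = a i"
    "\<forall>i. Suc i < R \<longrightarrow> (\<Sum>y\<in>UNIV. x i y * y) + (\<Sum>y\<in>UNIV. x (Suc i) y * inverse y) = p i"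
    "R > 0 \<longrightarrow> (\<Sum>y\<in>UNIV. x (R - 1) y * y) = p (R - 1) - \<tau>"
    "(\<Sum>i<R. card {y. x i y \<noteq> 0}) = N"
    using reach_imp_coefficients[OF N(1)] by blast
  define f where "f c = (case c of None \<Rightarrow> \<tau> | Some (i, y) \<Rightarrow> x i y)" for c
  have "weight (base_columns R) f = R"
    using N(2) x(4) by (simp add: weight_base_columns f_def)
  moreover have "syndrome (base_entry R) (base_columns R) f (i, b) = v (i, b)" if "i < R" for i b
  proof (cases b)
    case True
    show ?thesis
    proof (cases "Suc i < R")
      case 1: True
      then show ?thesis using True that x(2) by (simp add: syndrome_base_True f_def p_def)
    next
      case False
      then have "R - 1 = i" using that by simp
      then show ?thesis using True False that x(3) by (simp add: syndrome_base_True f_def p_def)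
    qed
  next
    case False
    then show ?thesis using that x(1) by (simp add: syndrome_base_False f_def a_def)
  qed
  ultimately show ?thesis by auto
qed

text \<open>Applied with sum 1 to identify the column used in a block, and with sum 0 to show that a
  block of vanishing sum never uses exactly one column.\<close>

lemma single_support:
  fixes f :: "'b::finite \<Rightarrow> 'a::comm_monoid_add"
  assumes "card {y. f y \<noteq> 0} = 1" "sum f UNIV = s"
  shows "\<exists>z. \<forall>y. f y = (if y = z then s else 0)"
proof -
  obtain z where z: "{y. f y \<noteq> 0} = {z}" using assms by (metis card_1_singletonE)
  then have 0: "f y = 0" if "y \<noteq> z" for y using that by blast
  have "sum f UNIV = sum f {z}"
    by (rule sum.mono_neutral_right) (use 0 in auto)
  then show ?thesis using 0 assms(2) by (intro exI[of _ z]) auto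
qed

lemma all_one_if_sum_le:
  fixes n :: "nat \<Rightarrow> nat"
  assumes "\<And>i. i < K \<Longrightarrow> n i \<ge> 1" "(\<Sum>i<K. n i) \<le> K" "i < K"
  shows "n i = 1"
proof (rule ccontr)
  assume "n i \<noteq> 1"
  then have "(\<Sum>i<K. 1) < (\<Sum>i<K. n i)"
    using assms by (intro sum_strict_mono_ex1) (auto intro!: bexI[of _ i] simp: le_neq_implies_less)
  then show False using assms(2) by simp
qed

text \<open>Witnesses for local optimality: \<open>K = R\<close> gives words through block columns,
  and \<open>K = R - 1\<close> trades the top block for the extra column.\<close>

definition unit_word :: "nat \<Rightarrow> nat \<Rightarrow> (nat \<Rightarrow> 'a::{field,finite}) \<Rightarrow> (nat \<times> 'a) option \<Rightarrow> 'a" where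
  "unit_word R K Y c = (case c of None \<Rightarrow> if K < R then 1 else 0
     | Some (i, y) \<Rightarrow> if i < K \<and> y = Y i then 1 else 0)"

text \<open>Every block below \<open>K\<close> has sum 1 and needs a column, and the weight bound
  then allows only one. For \<open>K < R\<close> the top block has sum 0, so it cannot hold a single
  column and is empty, and \<open>p (R - 1)\<close> forces the extra column. The coordinates
  \<open>p i\<close> then determine the parameters from the top down, each from the block
  above.\<close>

lemma base_unique_representation:
  fixes Y :: "nat \<Rightarrow> 'a::{field,finite}"
  assumes K: "K = R \<or> Suc K = R"
    and w: "weight (base_columns R) f \<le> R"
    and s: "\<forall>i\<in>{..<R} \<times> UNIV. syndrome (base_entry R) (base_columns R) f i =
      syndrome (base_entry R) (base_columns R) (unit_word R K Y) i"
    and d: "d \<in> base_columns R"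
  shows "f d = unit_word R K Y d"
proof -
  have a: "(\<Sum>y\<in>UNIV. f (Some (i, y))) = (if i < K then 1 else 0)" if "i < R" for i
    using s[rule_format, of "(i, False)"] that by (simp add: syndrome_base_False unit_word_def)
  have p: "(\<Sum>y\<in>UNIV. f (Some (i, y)) * y) +
      (if Suc i < R then \<Sum>y\<in>UNIV. f (Some (Suc i, y)) * inverse y else f None) =
      (if i < K then Y i else 0) +
      (if Suc i < R then if Suc i < K then inverse (Y (Suc i)) else 0 else if K < R then 1 else 0)"
    if "i < R" for i
    using s[rule_format, of "(i, True)"] that
    by (simp add: syndrome_base_True unit_word_def if_distrib[of "\<lambda>t. t * _"] cong: if_cong)
  define n where "n i = card {y. f (Some (i, y)) \<noteq> 0}" for i
  have n1: "n i \<ge> 1" if "i < K" for i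
  proof (rule ccontr)
    assume "\<not> n i \<ge> 1"
    then have "n i = 0" by simp
    then have "f (Some (i, y)) = 0" for y by (auto simp: n_def)
    then show False using a[of i] that K by auto
  qed
  have w': "(if f None = 0 then 0 else 1) + (\<Sum>i<R. n i) \<le> R"
    using w by (simp add: weight_base_columns n_def)
  have K_le: "(\<Sum>i<K. n i) \<ge> K" using sum_mono[of "{..<K}" "\<lambda>_. 1" n] n1 by simp
  have last: "(\<Sum>i<K. n i) \<le> K \<and> f None = (if K < R then 1 else 0) \<and> (\<forall>i<R. i \<ge> K \<longrightarrow> n i = 0)"
  proof (cases "K = R")
    case True
    then show ?thesis using w' K_le by (auto split: if_splits)
  next
    case False
    then have R: "R = Suc K" using K by simp
    have "n K \<noteq> 1"
    proof
      assume "n K = 1"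
      then obtain z where "\<forall>y. f (Some (K, y)) = (if y = z then 0 else 0)"
        using single_support[of "\<lambda>y. f (Some (K, y))" 0] a[of K] R unfolding n_def by auto
      then have "f (Some (K, y)) = 0" for y by simp
      then show False using \<open>n K = 1\<close> by (simp add: n_def)
    qed
    moreover have "n K \<le> 1" using w' K_le R by simp
    ultimately have nK: "n K = 0" by simp
    then have "f (Some (K, y)) = 0" for y by (auto simp: n_def)
    then have "f None = 1" using p[of K] R by simp
    then show ?thesis using w' R nK by (auto simp: less_Suc_eq)
  qed
  have "\<exists>z. \<forall>y. f (Some (i, y)) = (if y = z then 1 else 0)" if "i < K" for i
  proof -
    have "card {y. f (Some (i, y)) \<noteq> 0} = 1"
      using all_one_if_sum_le[of K n i] n1 last that by (simp add: n_def)
    moreover have "(\<Sum>y\<in>UNIV. f (Some (i, y))) = 1" using a[of i] that K by auto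
    ultimately show ?thesis by (rule single_support)
  qed
  then obtain z where z: "f (Some (i, y)) = (if y = z i then 1 else 0)" if "i < K" for i y
    by metis
  have zero: "f (Some (i, y)) = 0" if "i < R" "i \<ge> K" for i y
    using last that by (auto simp: n_def)
  have zY: "z i = Y i" if "i < K" for i
    using that
  proof (induction "K - i" arbitrary: i rule: less_induct)
    case less
    have i: "i < R" using less.prems K by auto
    show ?case
    proof (cases "Suc i < K")
      case True
      then have "z (Suc i) = Y (Suc i)" using less by simp
      then show ?thesis using p[OF i] True z K less.prems
        by (auto simp: if_distrib[of "\<lambda>t. t * _"] cong: if_cong)
    next
      case False
      then show ?thesis using p[OF i] z zero K less.prems last
        by (auto simp: if_distrib[of "\<lambda>t. t * _"] cong: if_cong split: if_splits)
    qed
  qed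
  have "f (Some (i, y)) = unit_word R K Y (Some (i, y))" if "i < R" for i y
    using that z[of i y] zero[of i y] zY[of i] by (cases "i < K") (auto simp: unit_word_def)
  moreover have "f None = unit_word R K Y None" using last by (simp add: unit_word_def)
  ultimately show ?thesis using d by (auto simp: base_columns_def)
qed

lemma base_locally_optimal:
  fixes c :: "(nat \<times> 'a::{field,finite}) option"
  assumes R: "R \<ge> 1" and c: "c \<in> base_columns R"
  shows "\<exists>f0. weight (base_columns R) f0 = R \<and> f0 c \<noteq> 0 \<and>
    (\<forall>f. weight (base_columns R) f \<le> R \<longrightarrow>
      (\<forall>i\<in>{..<R} \<times> UNIV. syndrome (base_entry R) (base_columns R) f i =
        syndrome (base_entry R) (base_columns R) f0 i) \<longrightarrow> (\<forall>d\<in>base_columns R. f d = f0 d))"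
proof -
  obtain K Y where K: "K = R \<or> Suc K = R"
    and cK: "(case c of None \<Rightarrow> K < R | Some (i, y) \<Rightarrow> i < K \<and> y = Y i)"
  proof (cases c)
    case None
    then show thesis using that[of "R - 1"] R by auto
  next
    case (Some iy)
    then show thesis using that[of R "\<lambda>_. snd iy"] c by (auto simp: base_columns_def)
  qed
  let ?u = "unit_word R K Y"
  have "(\<Sum>i<R. card {y. ?u (Some (i, y)) \<noteq> 0}) = (\<Sum>i<R. if i < K then 1 else 0)"
    by (rule sum.cong) (auto simp: unit_word_def)
  also have "\<dots> = K" using K by (auto simp: sum.If_cases Int_absorb1 lessThan_def[symmetric])
  finally have "weight (base_columns R) ?u = R"
    using K by (auto simp: weight_base_columns unit_word_def)
  moreover have "?u c \<noteq> 0" using cK by (auto simp: unit_word_def split: option.splits)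
  ultimately show ?thesis
    using base_unique_representation[OF K, where Y = Y] by (intro exI[of _ ?u]) blast
qed

text \<open>Block sums vanish, so a block in use holds at least two columns. With weight at most 2
  there is just one such block, its coefficients are opposite, and its coordinate \<open>p i\<close>
  is a nonzero multiple of \<open>y1 - y2\<close>, as neither the block above nor the extra column
  contributes.\<close>

lemma base_distance_ge_3:
  fixes f :: "(nat \<times> 'a::{field,finite}) option \<Rightarrow> 'a"
  assumes R: "R \<ge> 1" and s: "\<forall>i\<in>{..<R} \<times> UNIV. syndrome (base_entry R) (base_columns R) f i = 0"
    and nz: "\<exists>c\<in>base_columns R. f c \<noteq> 0"
  shows "weight (base_columns R) f \<ge> 3"
proof (rule ccontr)
  assume "\<not> weight (base_columns R) f \<ge> 3"
  define n where "n i = card {y. f (Some (i, y)) \<noteq> 0}" for i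
  then have w: "(if f None = 0 then 0 else 1) + (\<Sum>i<R. n i) \<le> 2"
    using \<open>\<not> _\<close> by (simp add: weight_base_columns)
  have a: "(\<Sum>y\<in>UNIV. f (Some (i, y))) = 0" if "i < R" for i
    using s[rule_format, of "(i, False)"] that by (simp add: syndrome_base_False)
  have p: "(\<Sum>y\<in>UNIV. f (Some (i, y)) * y) +
      (if Suc i < R then \<Sum>y\<in>UNIV. f (Some (Suc i, y)) * inverse y else f None) = 0"
    if "i < R" for i
    using s[rule_format, of "(i, True)"] that by (simp add: syndrome_base_True)
  have z: "f (Some (i, y)) = 0" if "n i = 0" for i y
    using that by (auto simp: n_def)
  have n1: "n i \<noteq> 1" if iR: "i < R" for i
  proof
    assume "n i = 1"
    then obtain z where "\<forall>y. f (Some (i, y)) = (if y = z then 0 else 0)"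
      using single_support[of "\<lambda>y. f (Some (i, y))" 0] a[OF iR] unfolding n_def by auto
    then have "f (Some (i, y)) = 0" for y by simp
    then show False using \<open>n i = 1\<close> by (simp add: n_def)
  qed
  have "\<exists>i<R. n i \<noteq> 0"
  proof (rule ccontr)
    assume "\<not> (\<exists>i<R. n i \<noteq> 0)"
    then have 0: "\<And>i y. i < R \<Longrightarrow> f (Some (i, y)) = 0" using z by blast
    then have "f None = 0" using p[of "R - 1"] R by simp
    then show False using nz 0 by (auto simp: base_columns_def)
  qed
  then obtain i where i: "i < R" "n i \<noteq> 0" by blast
  then have ni: "n i \<ge> 2" using n1[of i] by simp
  have "(\<Sum>j<R. n j) = n i + (\<Sum>j\<in>{..<R} - {i}. n j)"
    using i by (subst sum.remove[of _ i]) auto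
  then have "n i = 2" and "(\<Sum>j\<in>{..<R} - {i}. n j) = 0" and "\<not> (\<Sum>j<R. n j) \<le> 1"
    using w ni by linarith+
  then have rest: "n j = 0" if "j < R" "j \<noteq> i" for j using that by simp
  have f0: "f None = 0" using w \<open>\<not> (\<Sum>j<R. n j) \<le> 1\<close> by (auto split: if_splits)
  obtain y1 y2 where y: "{y. f (Some (i, y)) \<noteq> 0} = {y1, y2}" "y1 \<noteq> y2"
    using \<open>n i = 2\<close> unfolding n_def card_2_iff by blast
  have sum2: "(\<Sum>y\<in>UNIV. f (Some (i, y)) * g y) = f (Some (i, y1)) * g y1 + f (Some (i, y2)) * g y2" for g
  proof -
    have "(\<Sum>y\<in>UNIV. f (Some (i, y)) * g y) = (\<Sum>y\<in>{y1, y2}. f (Some (i, y)) * g y)"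
      by (rule sum.mono_neutral_right) (use y in auto)
    then show ?thesis using y(2) by simp
  qed
  have e1: "f (Some (i, y1)) + f (Some (i, y2)) = 0" using sum2[of "\<lambda>_. 1"] a[OF i(1)] by simp
  have "f (Some (Suc i, y)) = 0" if "Suc i < R" for y
    by (rule z) (use rest that in auto)
  then have "f (Some (i, y1)) * y1 + f (Some (i, y2)) * y2 = 0"
    using p[OF i(1)] sum2[of "\<lambda>y. y"] f0 by (simp split: if_splits)
  moreover have "f (Some (i, y2)) = - f (Some (i, y1))" using e1 by (simp add: eq_neg_iff_add_eq_0 add.commute)
  ultimately have "f (Some (i, y1)) * (y1 - y2) = 0" by (simp add: algebra_simps)
  then show False using y by auto
qed

lemma base_distance_le_3:
  assumes two: "(2::'a::{field,finite}) \<noteq> 0" and R: "R \<ge> 1"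
  shows "\<exists>f :: (nat \<times> 'a) option \<Rightarrow> 'a.
    (\<forall>i\<in>{..<R} \<times> UNIV. syndrome (base_entry R) (base_columns R) f i = 0) \<and>
    weight (base_columns R) f = 3"
proof -
  have m1: "(1::'a) \<noteq> - 1"
  proof
    assume "(1::'a) = - 1"
    then have "(1::'a) + 1 = 0" by (metis add.right_inverse)
    then show False using two by simp
  qed
  \<comment> \<open>The rows see block 0 only through its sum and its first moment; both vanish for
    the coefficients -2, 1, 1 at the parameters 0, 1, -1.\<close>
  let ?g = "\<lambda>y::'a. if y = 0 then - 2 else if y = 1 \<or> y = - 1 then 1 else (0::'a)"
  let ?f = "\<lambda>c. case c of None \<Rightarrow> 0 | Some (i, y) \<Rightarrow> if i = (0::nat) then ?g y else 0"
  have supp: "{y. ?g y \<noteq> 0} = {0, 1, - 1}" using two by auto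
  have g: "(\<Sum>y\<in>UNIV. ?g y * h y) = - 2 * h 0 + h 1 + h (- 1)" for h
  proof -
    have "(\<Sum>y\<in>UNIV. ?g y * h y) = (\<Sum>y\<in>{0, 1, - 1}. ?g y * h y)"
      by (rule sum.mono_neutral_right) auto
    then show ?thesis using m1 by (simp add: add.assoc)
  qed
  have g0: "(\<Sum>y\<in>UNIV. ?g y) = 0" "(\<Sum>y\<in>UNIV. ?g y * y) = 0"
    using g[of "\<lambda>_. 1"] g[of "\<lambda>y. y"] by (simp_all only: mult_1_right mult_zero_right) auto
  have "syndrome (base_entry R) (base_columns R) ?f (i, b) = 0" if "i < R" for i b
    using that g0 by (cases b; cases "i = 0") (simp_all only: syndrome_base_True syndrome_base_False, simp_all)
  moreover have "weight (base_columns R) ?f = 3"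
  proof -
    have "(\<Sum>i<R. card {y. ?f (Some (i, y)) \<noteq> 0}) = (\<Sum>i<R. if i = 0 then 3 else 0)"
    proof (rule sum.cong)
      fix i :: nat
      have "card {0, 1, - 1 :: 'a} = 3" using m1 by (simp add: card_insert_if)
      then show "card {y. ?f (Some (i, y)) \<noteq> 0} = (if i = 0 then 3 else 0)"
        using supp by (cases "i = 0") simp_all
    qed simp
    then show ?thesis using R unfolding weight_base_columns by simp
  qed
  ultimately show ?thesis by (intro exI[of _ ?f]) auto
qed

lemma base_covering_system:
  assumes "CARD('a::{field,finite}) \<ge> 7" "(2::'a) \<noteq> 0" "R \<ge> 3"
  shows "covering_system ({..<R} \<times> UNIV) (base_columns R)
    (base_entry R :: _ \<Rightarrow> (nat \<times> 'a) option \<Rightarrow> 'a) R"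
  unfolding covering_system_def
  using base_surface_covering[OF assms] base_locally_optimal[of R] base_distance_ge_3[of R]
    base_distance_le_3[OF assms(2), of R] assms(3)
  by (intro conjI allI ballI impI; simp)

section \<open>Lifting the codimension\<close>

text \<open>The rows \<open>Inl i\<close> of the lifted matrix ignore the second component of a
  column, so they see a lifted word only through these sums.\<close>

definition fibre_sum :: "'x set \<Rightarrow> ('c \<times> 'x \<Rightarrow> 'a::comm_ring) \<Rightarrow> 'c \<Rightarrow> 'a" where
  "fibre_sum U F c = (\<Sum>x\<in>U. F (c, x))"

definition place :: "('c \<Rightarrow> 'x) \<Rightarrow> ('c \<Rightarrow> 'a::zero) \<Rightarrow> 'c \<times> 'x \<Rightarrow> 'a" where
  "place x f = (\<lambda>(c, y). if y = x c then f c else 0)"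

fun lifted_entry :: "('i \<Rightarrow> 'c \<Rightarrow> 'a) \<Rightarrow> ('c \<Rightarrow> 'x \<Rightarrow> 's \<Rightarrow> 'a) \<Rightarrow> 'i + 's \<Rightarrow> 'c \<times> 'x \<Rightarrow> 'a" where
  "lifted_entry M L (Inl i) (c, x) = M i c"
| "lifted_entry M L (Inr s) (c, x) = L c x s"

lemma syndrome_lifted_Inl:
  "syndrome (lifted_entry M L) (C \<times> U) F (Inl i) = syndrome M C (fibre_sum U F) i"
  by (simp add: syndrome_def fibre_sum_def sum.cartesian_product' sum_distrib_right)

lemma syndrome_lifted_Inr:
  "syndrome (lifted_entry M L) (C \<times> U) F (Inr s) = (\<Sum>c\<in>C. \<Sum>x\<in>U. F (c, x) * L c x s)"
  by (simp add: syndrome_def sum.cartesian_product')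

lemma fibre_sum_place:
  "finite U \<Longrightarrow> x c \<in> U \<Longrightarrow> fibre_sum U (place x f) c = f c"
  by (simp add: fibre_sum_def place_def)

lemma sum_place:
  fixes f :: "'c \<Rightarrow> 'a::comm_ring"
  assumes "finite U" "\<forall>c\<in>C. x c \<in> U"
  shows "(\<Sum>c\<in>C. \<Sum>y\<in>U. place x f (c, y) * L c y s) = (\<Sum>c\<in>C. f c * L c (x c) s)"
  using assms by (intro sum.cong) (auto simp: place_def if_distrib[of "\<lambda>t. t * _"] cong: if_cong)

lemma weight_place:
  assumes "\<forall>c\<in>C. x c \<in> U"
  shows "weight (C \<times> U) (place x f) = weight C f"
proof -
  have "{d \<in> C \<times> U. place x f d \<noteq> 0} = (\<lambda>c. (c, x c)) ` {c \<in> C. f c \<noteq> 0}"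
    using assms by (auto simp: place_def split: if_splits)
  then show ?thesis unfolding weight_def by (simp add: card_image inj_on_def)
qed

lemma support_fibre_sum:
  "{c \<in> C. fibre_sum U F c \<noteq> 0} \<subseteq> fst ` {d \<in> C \<times> U. F d \<noteq> 0}"
proof
  fix c assume c: "c \<in> {c \<in> C. fibre_sum U F c \<noteq> 0}"
  then obtain y where "y \<in> U" "F (c, y) \<noteq> 0"
    unfolding fibre_sum_def by (auto elim: sum.not_neutral_contains_not_neutral)
  then show "c \<in> fst ` {d \<in> C \<times> U. F d \<noteq> 0}" using c by force
qed

lemma weight_fibre_sum_le:
  assumes "finite C" "finite U"
  shows "weight C (fibre_sum U F) \<le> weight (C \<times> U) F"
  unfolding weight_def using assms
  by (intro surj_card_le[OF _ support_fibre_sum]) auto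

text \<open>Summing over fibres never raises the weight. If it does not lower it either,
  \<open>fst\<close> is injective on the support, so each fibre carries at most one nonzero
  coefficient. The element \<open>z\<close> is a default position for fibres outside the
  support.\<close>

lemma eq_place_if_weight_le:
  assumes fin: "finite C" "finite U" and z: "z \<in> U"
    and w: "weight (C \<times> U) F \<le> weight C (fibre_sum U F)"
  shows "\<exists>x. (\<forall>c\<in>C. x c \<in> U) \<and> (\<forall>d\<in>C \<times> U. F d = place x (fibre_sum U F) d)"
proof -
  let ?A = "{d \<in> C \<times> U. F d \<noteq> 0}" and ?B = "{c \<in> C. fibre_sum U F c \<noteq> 0}"
  have finA: "finite ?A" using fin by simp
  have "card (fst ` ?A) \<le> card ?B"
    using card_image_le[OF finA, of fst] w unfolding weight_def by linarith
  then have B: "?B = fst ` ?A"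
    by (intro card_seteq[OF finite_imageI[OF finA] support_fibre_sum])
  then have "card (fst ` ?A) = card ?A"
    using w card_image_le[OF finA, of fst] unfolding weight_def by simp
  then have inj: "inj_on fst ?A" by (rule eq_card_imp_inj_on[OF finA])
  define x where "x c = (if c \<in> ?B then SOME y. (c, y) \<in> ?A else z)" for c
  have x: "(c, x c) \<in> ?A" if c: "c \<in> ?B" for c
  proof -
    have "\<exists>y. (c, y) \<in> ?A" using c unfolding B by auto
    then have "(c, SOME y. (c, y) \<in> ?A) \<in> ?A" by (rule someI_ex)
    then show ?thesis by (simp only: x_def c if_True)
  qed
  have 0: "F (c, y) = 0" if "c \<in> C" "y \<in> U" "y \<noteq> x c" for c y
  proof (rule ccontr)
    assume "F (c, y) \<noteq> 0"
    then have d: "(c, y) \<in> ?A" using that by simp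
    then have "c \<in> ?B" unfolding B by force
    then have "(c, y) = (c, x c)" using inj_onD[OF inj _ d x] by simp
    then show False using that by simp
  qed
  have xX: "x c \<in> U" if "c \<in> C" for c
    using x[of c] z by (cases "c \<in> ?B") (auto simp: x_def)
  have "F (c, y) = place x (fibre_sum U F) (c, y)" if "c \<in> C" "y \<in> U" for c y
  proof (cases "y = x c")
    case True
    have "fibre_sum U F c = F (c, x c) + (\<Sum>y\<in>U - {x c}. F (c, y))"
      unfolding fibre_sum_def using fin xX[OF that(1)] by (simp add: sum.remove)
    also have "(\<Sum>y\<in>U - {x c}. F (c, y)) = 0"
      by (rule sum.neutral) (use 0 that in auto)
    finally show ?thesis using True by (simp add: place_def)
  next
    case False
    then show ?thesis using 0 that by (simp add: place_def)
  qed
  then show ?thesis using xX by (intro exI[of _ x]) auto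
qed

text \<open>Injectivity of the maps attached to \<open>R\<close>-sets of columns already gives surjectivity, by counting.\<close>

lemma lift_covering_system:
  fixes M :: "'i \<Rightarrow> 'c \<Rightarrow> 'a::{field,finite}" and L :: "'c \<Rightarrow> 'x \<Rightarrow> 's \<Rightarrow> 'a"
  assumes sys: "covering_system I C M R" and C: "finite C" "card C \<ge> R" and R: "R > 0"
    and U: "finite U" "finite S" "card U ^ R = CARD('a) ^ card S"
    and z: "z \<in> U" "\<And>c s. c \<in> C \<Longrightarrow> s \<in> S \<Longrightarrow> L c z s = 0"
    and inj: "\<And>J a x x'. J \<subseteq> C \<Longrightarrow> card J = R \<Longrightarrow> (\<And>j. j \<in> J \<Longrightarrow> a j \<noteq> 0) \<Longrightarrow>
      (\<And>j. j \<in> J \<Longrightarrow> x j \<in> U) \<Longrightarrow> (\<And>j. j \<in> J \<Longrightarrow> x' j \<in> U) \<Longrightarrow>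
      (\<And>s. s \<in> S \<Longrightarrow> (\<Sum>j\<in>J. a j * L j (x j) s) = (\<Sum>j\<in>J. a j * L j (x' j) s)) \<Longrightarrow>
      \<forall>j\<in>J. x j = x' j"
  shows "covering_system (I <+> S) (C \<times> U) (lifted_entry M L) R"
proof -
  let ?M = "lifted_entry M L"
  have inl: "\<And>i. i \<in> I \<Longrightarrow> Inl i \<in> I <+> S" and inr: "\<And>s. s \<in> S \<Longrightarrow> Inr s \<in> I <+> S" by auto
  have restrict_sum: "(\<Sum>c\<in>C. f c * g c) = (\<Sum>c\<in>{c \<in> C. f c \<noteq> 0}. f c * g c)" for f g :: "'c \<Rightarrow> 'a"
    using C by (intro sum.mono_neutral_right) auto
  have surj: "\<exists>x. (\<forall>c\<in>C. x c \<in> U) \<and> (\<forall>s\<in>S. (\<Sum>c\<in>C. f c * L c (x c) s) = w s)"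
    if "weight C f = R" for f w
  proof -
    let ?J = "{c \<in> C. f c \<noteq> 0}"
    define \<Psi> where "\<Psi> x = restrict (\<lambda>s. \<Sum>j\<in>?J. f j * L j (x j) s) S" for x
    have J: "?J \<subseteq> C" "card ?J = R" "finite ?J" using that C by (auto simp: weight_def)
    have sub: "\<Psi> ` (?J \<rightarrow>\<^sub>E U) \<subseteq> (S \<rightarrow>\<^sub>E UNIV)" by (auto simp: \<Psi>_def)
    have "inj_on \<Psi> (?J \<rightarrow>\<^sub>E U)"
    proof (rule inj_onI)
      fix x x' assume x: "x \<in> ?J \<rightarrow>\<^sub>E U" "x' \<in> ?J \<rightarrow>\<^sub>E U" and eq: "\<Psi> x = \<Psi> x'"
      have "\<forall>j\<in>?J. x j = x' j"
      proof (rule inj[OF J(1,2)])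
        fix s assume "s \<in> S"
        then show "(\<Sum>j\<in>?J. f j * L j (x j) s) = (\<Sum>j\<in>?J. f j * L j (x' j) s)"
          using fun_cong[OF eq, of s] by (simp add: \<Psi>_def)
      qed (use x in auto)
      then show "x = x'" using x by (intro PiE_ext) auto
    qed
    then have "card (\<Psi> ` (?J \<rightarrow>\<^sub>E U)) = card U ^ R"
      using J by (simp add: card_image card_PiE)
    also have "\<dots> = card (S \<rightarrow>\<^sub>E (UNIV :: 'a set))"
      using U by (simp add: card_PiE)
    finally have "\<Psi> ` (?J \<rightarrow>\<^sub>E U) = (S \<rightarrow>\<^sub>E UNIV)"
      using sub U by (intro card_subset_eq) (auto intro: finite_PiE)
    then have "restrict w S \<in> \<Psi> ` (?J \<rightarrow>\<^sub>E U)" by simp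
    then obtain x where x: "x \<in> ?J \<rightarrow>\<^sub>E U" "restrict w S = \<Psi> x" by blast
    have "(\<Sum>c\<in>C. f c * L c (if c \<in> ?J then x c else z) s) = w s" if "s \<in> S" for s
    proof -
      have "(\<Sum>c\<in>C. f c * L c (if c \<in> ?J then x c else z) s) = (\<Sum>c\<in>?J. f c * L c (x c) s)"
        by (subst restrict_sum) (auto intro: sum.cong)
      then show ?thesis using fun_cong[OF x(2), of s] that by (simp add: \<Psi>_def)
    qed
    moreover have "\<forall>c\<in>C. (if c \<in> ?J then x c else z) \<in> U" using x z by auto
    ultimately show ?thesis by (intro exI[of _ "\<lambda>c. if c \<in> ?J then x c else z"]) simp
  qed
  have syn_place: "syndrome ?M (C \<times> U) (place x f) (Inl i) = syndrome M C f i"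
    "syndrome ?M (C \<times> U) (place x f) (Inr s) = (\<Sum>c\<in>C. f c * L c (x c) s)"
    if "\<forall>c\<in>C. x c \<in> U" for x f i s
  proof -
    have "syndrome M C (fibre_sum U (place x f)) i = syndrome M C f i"
      unfolding syndrome_def using that U by (intro sum.cong) (auto simp: fibre_sum_place)
    then show "syndrome ?M (C \<times> U) (place x f) (Inl i) = syndrome M C f i"
      by (simp add: syndrome_lifted_Inl)
  qed (use sum_place[OF U(1) that] in \<open>simp add: syndrome_lifted_Inr\<close>)
  have covering: "\<exists>F. weight (C \<times> U) F = R \<and> (\<forall>i\<in>I <+> S. syndrome ?M (C \<times> U) F i = v i)" for v
  proof -
    obtain f where f: "weight C f = R" "\<forall>i\<in>I. syndrome M C f i = v (Inl i)"
      using sys unfolding covering_system_def by (elim conjE) (drule spec[of _ "\<lambda>i. v (Inl i)"], blast)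
    obtain x where x: "\<forall>c\<in>C. x c \<in> U" "\<forall>s\<in>S. (\<Sum>c\<in>C. f c * L c (x c) s) = v (Inr s)"
      using surj[OF f(1), of "\<lambda>s. v (Inr s)"] by blast
    show ?thesis
      using f x by (intro exI[of _ "place x f"]) (auto simp: weight_place syn_place)
  qed
  have optimal: "\<exists>F0. weight (C \<times> U) F0 = R \<and> F0 d \<noteq> 0 \<and>
      (\<forall>F. weight (C \<times> U) F \<le> R \<longrightarrow>
        (\<forall>i\<in>I <+> S. syndrome ?M (C \<times> U) F i = syndrome ?M (C \<times> U) F0 i) \<longrightarrow>
        (\<forall>d\<in>C \<times> U. F d = F0 d))" if d: "d \<in> C \<times> U" for d
  proof -
    obtain c y where cy: "d = (c, y)" "c \<in> C" "y \<in> U" using d by auto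
    have "\<forall>c\<in>C. \<exists>f0. weight C f0 = R \<and> f0 c \<noteq> 0 \<and>
        (\<forall>f. weight C f \<le> R \<longrightarrow> (\<forall>i\<in>I. syndrome M C f i = syndrome M C f0 i) \<longrightarrow>
           (\<forall>d\<in>C. f d = f0 d))"
      using sys unfolding covering_system_def by (elim conjE)
    from bspec[OF this cy(2)] obtain f0 where f0: "weight C f0 = R" "f0 c \<noteq> 0"
      and uniq: "\<forall>f. weight C f \<le> R \<longrightarrow>
        (\<forall>i\<in>I. syndrome M C f i = syndrome M C f0 i) \<longrightarrow> (\<forall>d\<in>C. f d = f0 d)"
      by (elim exE conjE)
    have x0: "\<forall>c\<in>C. y \<in> U" using cy by simp
    let ?F0 = "place (\<lambda>_. y) f0"
    show ?thesis
    proof (intro exI[of _ ?F0] conjI allI impI)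
      fix F assume w: "weight (C \<times> U) F \<le> R"
        and s: "\<forall>i\<in>I <+> S. syndrome ?M (C \<times> U) F i = syndrome ?M (C \<times> U) ?F0 i"
      \<comment> \<open>Uniqueness in the base system fixes the fibre sums; their weight
        \<open>R\<close> then forces \<open>F\<close> to be a placed word, and \<open>inj\<close>
        fixes its positions.\<close>
      have eq: "\<forall>d\<in>C. fibre_sum U F d = f0 d"
      proof (rule uniq[THEN spec, THEN mp, THEN mp])
        show "weight C (fibre_sum U F) \<le> R" using weight_fibre_sum_le[OF C(1) U(1), of F] w by simp
        show "\<forall>i\<in>I. syndrome M C (fibre_sum U F) i = syndrome M C f0 i"
          using s inl syn_place(1)[OF x0] by (metis syndrome_lifted_Inl)
      qed
      then have "{c \<in> C. fibre_sum U F c \<noteq> 0} = {c \<in> C. f0 c \<noteq> 0}" by auto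
      then have wR: "weight C (fibre_sum U F) = R" using f0(1) by (simp add: weight_def)
      obtain x where x: "\<forall>c\<in>C. x c \<in> U" "\<forall>d\<in>C \<times> U. F d = place x (fibre_sum U F) d"
        using eq_place_if_weight_le[OF C(1) U(1) z(1), of F] w unfolding wR by blast
      then have F: "F d = place x f0 d" if "d \<in> C \<times> U" for d
        using that eq by (auto simp: place_def)
      let ?J = "{c \<in> C. f0 c \<noteq> 0}"
      have "\<forall>j\<in>?J. x j = y"
      proof (rule inj)
        show "?J \<subseteq> C" "card ?J = R" using f0 by (auto simp: weight_def)
        fix s assume "s \<in> S"
        have "(\<Sum>c\<in>C. f0 c * L c (x c) s) = syndrome ?M (C \<times> U) (place x f0) (Inr s)"
          using syn_place(2)[OF x(1)] by simp
        also have "\<dots> = syndrome ?M (C \<times> U) F (Inr s)"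
          unfolding syndrome_def by (rule sum.cong) (use F in auto)
        also have "\<dots> = syndrome ?M (C \<times> U) ?F0 (Inr s)" using s inr[OF \<open>s \<in> S\<close>] by blast
        also have "\<dots> = (\<Sum>c\<in>C. f0 c * L c y s)" by (rule syn_place(2)[OF x0])
        finally show "(\<Sum>j\<in>?J. f0 j * L j (x j) s) = (\<Sum>j\<in>?J. f0 j * L j y s)"
          by (simp only: restrict_sum[symmetric])
      qed (use x cy in auto)
      then show "\<forall>d\<in>C \<times> U. F d = ?F0 d" using F by (auto simp: place_def)
    qed (use f0 cy weight_place[OF x0] in \<open>auto simp: place_def\<close>)
  qed
  \<comment> \<open>Injectivity in one fibre follows from that for \<open>R\<close>-sets by padding
    with columns kept at \<open>z\<close>.\<close>
  have L_inj: "y = y'" if c: "c \<in> C" "y \<in> U" "y' \<in> U" and eq: "\<And>s. s \<in> S \<Longrightarrow> L c y s = L c y' s" for c y y'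
  proof -
    have "\<exists>J. c \<in> J \<and> J \<subseteq> C \<and> card J = R"
    proof -
      have "R - 1 \<le> card (C - {c})" using C c by simp
      then obtain J where "J \<subseteq> C - {c}" "card J = R - 1"
        by (rule obtain_subset_with_card_n)
      moreover from this have "finite J" "c \<notin> J" using C by (auto intro: finite_subset)
      ultimately show ?thesis using c R by (intro exI[of _ "insert c J"]) auto
    qed
    then obtain J where J: "c \<in> J" "J \<subseteq> C" "card J = R" by blast
    have "\<forall>j\<in>J. (if j = c then y else z) = (if j = c then y' else z)"
      by (rule inj[OF J(2,3), of "\<lambda>_. 1"]) (use c z eq in \<open>auto intro!: sum.cong\<close>)
    then show ?thesis using J(1) by auto
  qed
  have dist_ge: "weight (C \<times> U) F \<ge> 3"
    if s: "\<forall>i\<in>I <+> S. syndrome ?M (C \<times> U) F i = 0" and nz: "\<exists>d\<in>C \<times> U. F d \<noteq> 0" for F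
  proof (cases "\<exists>c\<in>C. fibre_sum U F c \<noteq> 0")
    case True
    have "\<forall>i\<in>I. syndrome M C (fibre_sum U F) i = 0"
      using s inl by (metis syndrome_lifted_Inl)
    then have "weight C (fibre_sum U F) \<ge> 3" using sys True unfolding covering_system_def by blast
    then show ?thesis using weight_fibre_sum_le[OF C(1) U(1), of F] by simp
  next
    \<comment> \<open>All fibre sums vanish, so a nonzero entry has a partner in its fibre. If there
      are no further entries, the two coefficients are opposite and \<open>L_inj\<close> identifies
      the positions.\<close>
    case False
    show ?thesis
    proof (rule ccontr)
      assume "\<not> weight (C \<times> U) F \<ge> 3"
      then have w: "card {d \<in> C \<times> U. F d \<noteq> 0} \<le> 2" by (simp add: weight_def)
      obtain c y where cy: "c \<in> C" "y \<in> U" "F (c, y) \<noteq> 0" using nz by auto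
      have "(\<Sum>y\<in>U. F (c, y)) = F (c, y) + (\<Sum>y\<in>U - {y}. F (c, y))"
        using U cy by (simp add: sum.remove)
      then have "(\<Sum>y\<in>U - {y}. F (c, y)) \<noteq> 0" using False cy by (auto simp: fibre_sum_def)
      then obtain y' where y': "y' \<in> U" "y' \<noteq> y" "F (c, y') \<noteq> 0"
        by (auto elim: sum.not_neutral_contains_not_neutral)
      have fin: "finite {d \<in> C \<times> U. F d \<noteq> 0}" using C U by simp
      have "{(c, y), (c, y')} = {d \<in> C \<times> U. F d \<noteq> 0}"
        by (rule card_seteq[OF fin]) (use cy y' w in auto)
      then have "{d \<in> C \<times> U. F d \<noteq> 0} \<subseteq> {(c, y), (c, y')}" by simp
      then have 0: "F d = 0" if "d \<in> C \<times> U" "d \<noteq> (c, y)" "d \<noteq> (c, y')" for d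
        using subsetD[of _ _ d] that by blast
      have sum2: "(\<Sum>c'\<in>C. \<Sum>x\<in>U. F (c', x) * g c' x) = F (c, y) * g c y + F (c, y') * g c y'" for g
      proof -
        have "(\<Sum>c'\<in>C. \<Sum>x\<in>U. F (c', x) * g c' x) = (\<Sum>d\<in>C \<times> U. F d * g (fst d) (snd d))"
          by (simp add: sum.cartesian_product case_prod_unfold)
        also have "\<dots> = (\<Sum>d\<in>{(c, y), (c, y')}. F d * g (fst d) (snd d))"
          by (rule sum.mono_neutral_right) (use cy y' C U 0 in auto)
        finally show ?thesis using y' by simp
      qed
      have "(\<Sum>c'\<in>C. \<Sum>x\<in>U. F (c', x) * 1) = 0"
        using False by (simp add: fibre_sum_def)
      then have F': "F (c, y') = - F (c, y)"
        using sum2[of "\<lambda>_ _. 1"] by (simp add: eq_neg_iff_add_eq_0 add.commute)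
      have "L c y s = L c y' s" if "s \<in> S" for s
      proof -
        have "F (c, y) * L c y s + F (c, y') * L c y' s = 0"
          using bspec[OF s inr[OF that]] unfolding syndrome_lifted_Inr sum2 .
        then have "F (c, y) * (L c y s - L c y' s) = 0" by (simp add: F' algebra_simps)
        then show ?thesis using cy by simp
      qed
      then have "y = y'" using L_inj cy y' by blast
      then show False using y' by simp
    qed
  qed
  have "\<exists>F. (\<forall>i\<in>I <+> S. syndrome ?M (C \<times> U) F i = 0) \<and> weight (C \<times> U) F = 3"
  proof -
    \<comment> \<open>\<open>L\<close> vanishes at \<open>z\<close>, so a base word of weight 3
      placed there satisfies the new equations.\<close>
    obtain f where f: "\<forall>i\<in>I. syndrome M C f i = 0" "weight C f = 3"
      using sys unfolding covering_system_def by blast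
    have x0: "\<forall>c\<in>C. z \<in> U" using z by simp
    have "(\<Sum>c\<in>C. f c * L c z s) = 0" if "s \<in> S" for s
      by (rule sum.neutral) (use z that in auto)
    then show ?thesis
      using f by (intro exI[of _ "place (\<lambda>_. z) f"])
        (auto simp: weight_place[OF x0] syn_place[OF x0])
  qed
  then show ?thesis
    unfolding covering_system_def using covering optimal dist_ge by blast
qed

section \<open>Vandermonde systems on the projective line\<close>

definition proj_power :: "nat \<Rightarrow> 'b::field option \<Rightarrow> nat \<Rightarrow> 'b" where
  "proj_power R \<beta> i = (case \<beta> of Some b \<Rightarrow> b ^ i | None \<Rightarrow> if Suc i = R then 1 else 0)"

text \<open>The vectors \<open>proj_power R \<beta>\<close> form the normal rational curve, with (0,
  ..., 0, 1) as its point at infinity. Reading polynomials as functionals on it turns a Vandermonde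
  system into interpolation.\<close>

lemma sum_coeff_proj_power:
  assumes "Polynomial.degree p < R"
  shows "(\<Sum>i<R. Polynomial.coeff p i * proj_power R \<beta> i) =
    (case \<beta> of Some b \<Rightarrow> poly p b | None \<Rightarrow> Polynomial.coeff p (R - 1))"
proof (cases \<beta>)
  case None
  have "(\<Sum>i<R. Polynomial.coeff p i * proj_power R None i) =
      (\<Sum>i<R. if i = R - 1 then Polynomial.coeff p i else 0)"
    by (rule sum.cong) (auto simp: proj_power_def)
  then show ?thesis using None assms by simp
next
  case (Some b)
  have "poly p b = (\<Sum>i\<le>Polynomial.degree p. Polynomial.coeff p i * b ^ i)" by (rule poly_altdef)
  also have "\<dots> = (\<Sum>i<R. Polynomial.coeff p i * b ^ i)"
    using assms by (intro sum.mono_neutral_left) (auto simp: coeff_eq_0)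
  finally show ?thesis using Some by (simp add: proj_power_def)
qed

text \<open>The functional picking out the coefficient at \<open>k\<close> is given by the coefficients of the
  polynomial vanishing at all other nodes, where vanishing at the node \<open>None\<close> (infinity) means
  having degree less than \<open>R - 1\<close>.\<close>

lemma projective_vandermonde:
  fixes \<iota> :: "'j \<Rightarrow> 'b::field option"
  assumes J: "finite J" "card J = R" and inj: "inj_on \<iota> J"
    and 0: "\<And>i. i < R \<Longrightarrow> (\<Sum>j\<in>J. d j * proj_power R (\<iota> j) i) = 0"
    and k: "k \<in> J"
  shows "d k = 0"
proof -
  define lin where "lin j = (case \<iota> j of Some b \<Rightarrow> [:- b, 1:] | None \<Rightarrow> 1)" for j
  define P where "P = (\<Prod>j\<in>J - {k}. lin j)"
  let ?N = "{j \<in> J - {k}. \<iota> j \<noteq> None}"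
  have lin0: "lin j \<noteq> 0" for j by (simp add: lin_def split: option.splits)
  have "Polynomial.degree P = (\<Sum>j\<in>J - {k}. Polynomial.degree (lin j))"
    unfolding P_def by (rule degree_prod_eq_sum_degree) (simp add: lin0)
  also have "\<dots> = (\<Sum>j\<in>J - {k}. if \<iota> j \<noteq> None then 1 else 0)"
    by (rule sum.cong) (auto simp: lin_def split: option.splits)
  also have "\<dots> = card ?N" using J by (simp add: sum.If_cases Int_def)
  finally have deg: "Polynomial.degree P = card ?N" .
  have lead: "Polynomial.lead_coeff P = 1"
    unfolding P_def lead_coeff_prod by (rule prod.neutral) (auto simp: lin_def split: option.splits)
  have R: "R > 0" using J k by (auto simp: card_gt_0_iff)
  have cJ: "card (J - {k}) = R - 1" using J k by simp
  have "card ?N \<le> card (J - {k})" using J by (intro card_mono) auto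
  then have degR: "Polynomial.degree P < R" using deg cJ R by linarith
  let ?e = "\<lambda>j. case \<iota> j of Some b \<Rightarrow> poly P b | None \<Rightarrow> Polynomial.coeff P (R - 1)"
  have other: "?e j = 0" if "j \<in> J - {k}" for j
  proof (cases "\<iota> j")
    case None
    have "card ?N \<le> card (J - {k} - {j})" using J None by (intro card_mono) auto
    also have "\<dots> < card (J - {k})" using that J by (intro psubset_card_mono) auto
    finally show ?thesis using None deg cJ by (simp add: coeff_eq_0)
  next
    case (Some b)
    then have "poly (lin j) b = 0" by (simp add: lin_def)
    then have "poly P b = 0" using that J unfolding P_def poly_prod by (intro prod_zero) auto
    then show ?thesis using Some by simp
  qed
  have self: "?e k \<noteq> 0"
  proof (cases "\<iota> k")
    case None
    have "\<iota> j \<noteq> None" if "j \<in> J - {k}" for j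
      using inj_onD[OF inj, of j k] None k that by auto
    then have "?N = J - {k}" by blast
    then show ?thesis using None deg cJ lead by simp
  next
    case (Some b)
    have "poly (lin j) b \<noteq> 0" if "j \<in> J - {k}" for j
      using that inj k Some by (auto simp: lin_def inj_on_def split: option.splits)
    then show ?thesis using Some J unfolding P_def poly_prod by simp
  qed
  have "0 = (\<Sum>i<R. Polynomial.coeff P i * (\<Sum>j\<in>J. d j * proj_power R (\<iota> j) i))" using 0 by simp
  also have "\<dots> = (\<Sum>i<R. \<Sum>j\<in>J. d j * (Polynomial.coeff P i * proj_power R (\<iota> j) i))"
    by (simp add: sum_distrib_left mult_ac)
  also have "\<dots> = (\<Sum>j\<in>J. \<Sum>i<R. d j * (Polynomial.coeff P i * proj_power R (\<iota> j) i))"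
    by (rule sum.swap)
  also have "\<dots> = (\<Sum>j\<in>J. d j * ?e j)"
    by (simp add: sum_distrib_left[symmetric] sum_coeff_proj_power[OF degR])
  also have "\<dots> = d k * ?e k" using J k other by (simp add: sum.remove)
  finally show ?thesis using self by simp
qed

section \<open>The field of order \<open>q ^ m\<close> inside the algebraic closure\<close>

lemma power_card_field:
  fixes x :: "'a::{field,finite}"
  shows "x ^ CARD('a) = x"
proof (cases "x = 0")
  case False
  have "(\<Prod>y\<in>- {0}. x * y) = (\<Prod>y\<in>- {0}. y)"
    by (rule prod.reindex_bij_witness[of _ "\<lambda>y. y / x" "\<lambda>y. x * y"]) (use False in auto)
  then have "x ^ card (- {0 :: 'a}) = 1" by (simp add: prod.distrib)
  moreover have "CARD('a) = Suc (card (- {0 :: 'a}))"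
    by (simp add: card_Diff_singleton Compl_eq_Diff_UNIV)
  ultimately show ?thesis by simp
qed simp

lemma power_card_power_field:
  fixes x :: "'a::{field,finite}"
  shows "x ^ (CARD('a) ^ m) = x"
  by (induction m) (simp_all add: power_mult power_card_field)

lemma card_field_eq_CHAR_power:
  assumes "primepow (CARD('a::{field,finite}))"
  shows "Factorial_Ring.prime CHAR('a)" "\<exists>k. CARD('a) = CHAR('a) ^ k"
proof -
  show p: "Factorial_Ring.prime CHAR('a)"
    using finite_imp_CHAR_pos[where ?'a = 'a] prime_CHAR_semidom[where ?'a = 'a] by simp
  obtain p k where "Factorial_Ring.prime p" "CARD('a) = p ^ k" using assms by (auto simp: primepow_def)
  moreover have "CHAR('a) dvd CARD('a)" by (rule CHAR_dvd_CARD)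
  ultimately have "CHAR('a) = p"
    using p by (metis prime_dvd_power primes_dvd_imp_eq)
  then show "\<exists>k. CARD('a) = CHAR('a) ^ k" using \<open>CARD('a) = p ^ k\<close> by blast
qed

text \<open>Over an algebraically closed field the polynomial splits, and a repeated factor would
  give a common root with the derivative.\<close>

lemma card_roots_eq_degree:
  fixes p :: "'b::alg_closed_field poly"
  assumes p: "p \<noteq> 0" and simple: "\<And>x. poly p x = 0 \<Longrightarrow> poly (pderiv p) x \<noteq> 0"
  shows "card {x. poly p x = 0} = Polynomial.degree p"
proof -
  obtain A where A: "size A = Polynomial.degree p" "p = smult (Polynomial.lead_coeff p) (\<Prod>x\<in>#A. [:-x, 1:])"
    using alg_closed_imp_factorization[OF p] by blast
  let ?c = "Polynomial.lead_coeff p"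
  have c: "?c \<noteq> 0" using p by simp
  have "poly p x = ?c * (\<Prod>y\<in>#A. x - y)" for x
    by (subst A(2)) (simp add: poly_prod_mset)
  then have roots: "{x. poly p x = 0} = set_mset A"
    using c by (auto simp: prod_mset_zero_iff)
  have "count A x \<le> 1" for x
  proof (rule ccontr)
    assume "\<not> count A x \<le> 1"
    then have "{#x, x#} \<subseteq># A" by (simp add: subseteq_mset_def)
    then obtain B where B: "A = {#x, x#} + B" by (metis subset_mset.add_diff_inverse)
    define g where "g = smult ?c (\<Prod>y\<in>#B. [:-y, 1:])"
    have pg: "p = [:-x, 1:] * ([:-x, 1:] * g)"
      by (subst A(2)) (simp add: B g_def)
    have "poly p x = 0" by (simp add: pg)
    moreover have "poly (pderiv p) x = 0"
      unfolding pg pderiv_mult poly_add poly_mult by simp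
    ultimately show False using simple by blast
  qed
  then have "mset_set (set_mset A) = A"
    by (intro multiset_eqI) (metis count_eq_zero_iff count_mset_set(1,3) finite_set_mset le_antisym not_one_le_zero One_nat_def less_one linorder_not_le)
  then have "card (set_mset A) = size A" by (metis size_mset_set)
  then show ?thesis using roots A(1) by simp
qed

text \<open>For a positive power \<open>Q\<close> of \<open>CARD('a)\<close> this is the fixed field
  of the Q-power Frobenius map, the set of roots of X ^ Q - X.\<close>

definition subfield_of_order :: "nat \<Rightarrow> 'a::field alg_closure set" where
  "subfield_of_order Q = {x. x ^ Q = x}"

lemma card_subfield_of_order:
  assumes q: "primepow (CARD('a::{field,finite}))" and m: "m > 0"
  shows "card (subfield_of_order (CARD('a) ^ m) :: 'a alg_closure set) = CARD('a) ^ m"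
proof -
  let ?Q = "CARD('a) ^ m"
  define p :: "'a alg_closure poly" where "p = Polynomial.monom 1 ?Q + [:0, - 1:]"
  have "CARD('a) > 1" using primepow_gt_Suc_0[OF q] by simp
  then have Q: "?Q > 1" using one_less_power[of "CARD('a)" m] m by simp
  have deg: "Polynomial.degree p = ?Q"
    unfolding p_def using Q by (subst degree_add_eq_left) (simp_all add: degree_monom_eq)
  \<comment> \<open>The derivative of X ^ Q - X reduces to -1, so all roots are simple.\<close>
  have "CHAR('a) dvd ?Q" using CHAR_dvd_CARD[where ?'a = 'a] m by (meson dvd_power dvd_trans)
  then have "(of_nat ?Q :: 'a alg_closure) = 0" by (simp only: of_nat_eq_0_iff_char_dvd CHAR_alg_closure)
  then have pd: "pderiv p = - 1"
    unfolding p_def by (simp only: pderiv_add pderiv_monom mult_1_right) (simp add: pderiv_pCons one_pCons)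
  have "poly p x = 0 \<longleftrightarrow> x ^ ?Q = x" for x by (simp add: p_def poly_monom)
  then have "subfield_of_order ?Q = {x. poly p x = 0}" by (simp add: subfield_of_order_def)
  moreover have "card {x. poly p x = 0} = Polynomial.degree p"
    by (rule card_roots_eq_degree) (use deg Q pd in auto)
  ultimately show ?thesis using deg by simp
qed

text \<open>Provides coordinates over the ground field for the elements of \<open>K\<close>. The
  dimension \<open>m\<close> is read off by comparing \<open>CARD('a) ^ card B\<close> with the
  order of \<open>K\<close>; linearity is stated for indexed sums, the form in which lifted
  syndromes occur.\<close>

lemma ex_coordinates:
  fixes K :: "'a::{field,finite} alg_closure set"
  assumes q: "primepow (CARD('a::{field,finite}))" and m: "m > 0"
    and K_def: "K = subfield_of_order (CARD('a::{field,finite}) ^ m)"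
  shows "\<exists>(B :: 'a::{field,finite} alg_closure set) r. finite B \<and> card B = m \<and> r 0 = (\<lambda>_. 0) \<and>
    (\<forall>(J :: 'j set) a x. (\<forall>j\<in>J. x j \<in> K) \<longrightarrow>
      (\<Sum>j\<in>J. to_ac (a j) * x j) \<in> K \<and>
      r (\<Sum>j\<in>J. to_ac (a j) * x j) = (\<lambda>b. \<Sum>j\<in>J. a j * r (x j) b)) \<and>
    (\<forall>u\<in>K. \<forall>v\<in>K. (\<forall>b\<in>B. r u b = r v b) \<longrightarrow> u = v)"
proof -
  let ?scale = "\<lambda>c x. to_ac (c :: 'a) * x"
  interpret vs: Vector_Spaces.vector_space ?scale
    by unfold_locales (simp_all add: algebra_simps)
  let ?Q = "CARD('a) ^ m"
  obtain k where k: "CARD('a) = CHAR('a) ^ k" using card_field_eq_CHAR_power(2)[OF q] by blast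
  have add: "(x + y) ^ ?Q = x ^ ?Q + y ^ ?Q" for x y :: "'a alg_closure"
    by (rule freshmans_dream'[where n = "k * m"])
      (use card_field_eq_CHAR_power(1)[OF q] k in \<open>simp_all add: power_mult\<close>)
  have Q: "?Q > 0" by simp
  have subspace: "vs.subspace K"
    unfolding vs.subspace_def K_def subfield_of_order_def
    using Q by (auto simp: add power_mult_distrib simp flip: to_ac_power simp: power_card_power_field)
  have cardK: "card K = ?Q" unfolding K_def by (rule card_subfield_of_order[OF q m])
  then have finK: "finite K" using Q by (intro card_ge_0_finite) simp
  obtain B where B: "B \<subseteq> K" "vs.independent B" "K \<subseteq> vs.span B"
    using vs.maximal_independent_subset[of K] by blast
  have span: "vs.span B = K"
    using B subspace by (intro antisym vs.span_minimal)
  have finB: "finite B" using B(1) finK by (rule finite_subset)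
  let ?r = "vs.representation B"
  have sum_rep: "(\<Sum>b\<in>B. to_ac (?r u b) * b) = u" if "u \<in> K" for u
    using vs.sum_representation_eq[OF B(2), of u B] that span finB by simp
  have inj: "u = v" if "u \<in> K" "v \<in> K" "\<And>b. b \<in> B \<Longrightarrow> ?r u b = ?r v b" for u v
  proof -
    have "(\<Sum>b\<in>B. to_ac (?r u b) * b) = (\<Sum>b\<in>B. to_ac (?r v b) * b)"
      by (rule sum.cong) (simp_all add: that(3))
    then show ?thesis unfolding sum_rep[OF that(1)] sum_rep[OF that(2)] .
  qed
  have "bij_betw (\<lambda>u. restrict (?r u) B) K (B \<rightarrow>\<^sub>E UNIV)"
  proof (rule bij_betwI')
    fix u v assume uv: "u \<in> K" "v \<in> K"
    show "restrict (?r u) B = restrict (?r v) B \<longleftrightarrow> u = v"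
    proof
      assume eq: "restrict (?r u) B = restrict (?r v) B"
      show "u = v"
      proof (rule inj[OF uv])
        fix b assume "b \<in> B"
        then show "?r u b = ?r v b" using fun_cong[OF eq, of b] by simp
      qed
    qed simp
  next
    fix f assume f: "f \<in> B \<rightarrow>\<^sub>E (UNIV :: 'a set)"
    let ?f = "\<lambda>b. if b \<in> B then f b else 0"
    let ?u = "\<Sum>b\<in>B. to_ac (f b) * b"
    have "?u \<in> vs.span B" by (intro vs.span_sum vs.span_scale vs.span_base)
    moreover have "?r ?u = ?f"
      by (rule vs.representation_eqI[OF B(2) calculation])
        (auto intro: finite_subset[OF _ finB] intro!: sum.mono_neutral_cong_left finB split: if_splits)
    ultimately show "\<exists>u\<in>K. f = restrict (?r u) B"
      using f span by (intro bexI[of _ ?u]) (auto simp: restrict_def PiE_def extensional_def fun_eq_iff)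
  qed auto
  then have "card K = card (B \<rightarrow>\<^sub>E (UNIV :: 'a set))" by (rule bij_betw_same_card)
  then have "CARD('a) ^ card B = CARD('a) ^ m" using cardK finB by (simp add: card_PiE)
  moreover have "CARD('a) > 1" using primepow_gt_Suc_0[OF q] by simp
  ultimately have cardB: "card B = m" by (simp add: power_inject_exp)
  have in_K: "(\<Sum>j\<in>J. to_ac (a j) * x j) \<in> K" if "\<forall>j\<in>J. x j \<in> K" for J :: "'j set" and a x
    using that by (intro vs.subspace_sum[OF subspace] vs.subspace_scale[OF subspace]) simp
  have r_sum: "?r (\<Sum>j\<in>J. to_ac (a j) * x j) = (\<lambda>b. \<Sum>j\<in>J. a j * ?r (x j) b)"
    if "\<forall>j\<in>J. x j \<in> K" for J :: "'j set" and a x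
  proof -
    have "?r (\<Sum>j\<in>J. to_ac (a j) * x j) = (\<lambda>b. \<Sum>j\<in>J. ?r (to_ac (a j) * x j) b)"
      using that by (intro vs.representation_sum[OF B(2)] vs.span_scale) (simp add: span)
    also have "\<dots> = (\<lambda>b. \<Sum>j\<in>J. a j * ?r (x j) b)"
      using that by (intro ext sum.cong) (simp_all add: vs.representation_scale[OF B(2)] span)
    finally show ?thesis .
  qed
  show ?thesis
  proof (intro exI[of _ B] exI[of _ ?r] conjI allI impI ballI)
    show "finite B" "card B = m" "?r 0 = (\<lambda>_. 0)" by (fact finB cardB vs.representation_zero)+
  next
    fix J :: "'j set" and a x
    assume "\<forall>j\<in>J. x j \<in> K"
    then show "(\<Sum>j\<in>J. to_ac (a j) * x j) \<in> K"
      "?r (\<Sum>j\<in>J. to_ac (a j) * x j) = (\<lambda>b. \<Sum>j\<in>J. a j * ?r (x j) b)"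
      by (fact in_K r_sum)+
  next
    fix u v assume "u \<in> K" "v \<in> K" "\<forall>b\<in>B. ?r u b = ?r v b"
    then show "u = v" using inj by blast
  qed
qed

section \<open>From covering systems to parity check matrices\<close>

lemma covering_systemD:
  assumes "covering_system I C M R"
  shows "\<exists>f. weight C f = R \<and> (\<forall>i\<in>I. syndrome M C f i = v i)"
    and "c \<in> C \<Longrightarrow> \<exists>f0. weight C f0 = R \<and> f0 c \<noteq> 0 \<and>
      (\<forall>f. weight C f \<le> R \<longrightarrow> (\<forall>i\<in>I. syndrome M C f i = syndrome M C f0 i) \<longrightarrow>
        (\<forall>d\<in>C. f d = f0 d))"
    and "(\<forall>i\<in>I. syndrome M C f i = 0) \<Longrightarrow> \<exists>c\<in>C. f c \<noteq> 0 \<Longrightarrow> weight C f \<ge> 3"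
    and "\<exists>f. (\<forall>i\<in>I. syndrome M C f i = 0) \<and> weight C f = 3"
  using assms unfolding covering_system_def by simp_all

lemma weight_cong: "(\<And>c. c \<in> C \<Longrightarrow> f c = g c) \<Longrightarrow> weight C f = weight C g"
  unfolding weight_def by (rule arg_cong[of _ _ card]) auto

lemma syndrome_cong:
  "(\<And>c. c \<in> C \<Longrightarrow> f c = g c) \<Longrightarrow> syndrome M C f i = syndrome M C g i"
  unfolding syndrome_def by (rule sum.cong) auto

text \<open>Transports a covering system from arbitrary index sets to the initial segments that
  index the rows and columns of a matrix. Words are pulled back along \<open>h\<close> and returned
  along its inverse \<open>k\<close>.\<close>

lemma covering_system_reindex:
  fixes M :: "'i \<Rightarrow> 'c \<Rightarrow> 'a::comm_ring" and g :: "'j \<Rightarrow> 'i" and h :: "'d \<Rightarrow> 'c"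
  assumes g: "bij_betw g I' I" and h: "bij_betw h C' C" and sys: "covering_system I C M R"
    and M': "\<And>i c. i \<in> I' \<Longrightarrow> c \<in> C' \<Longrightarrow> M' i c = M (g i) (h c)"
  shows "covering_system I' C' M' R"
proof -
  have w: "weight C' (f \<circ> h) = weight C f" for f :: "'c \<Rightarrow> 'a"
  proof -
    have "{c \<in> C. f c \<noteq> 0} = h ` {c \<in> C'. (f \<circ> h) c \<noteq> 0}"
      using h by (auto simp: bij_betw_def)
    moreover have "inj_on h {c \<in> C'. (f \<circ> h) c \<noteq> 0}"
      using h by (auto simp: bij_betw_def intro: inj_on_subset)
    ultimately show ?thesis unfolding weight_def by (simp add: card_image)
  qed
  have s: "syndrome M' C' (f \<circ> h) i = syndrome M C f (g i)" if "i \<in> I'" for f i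
    unfolding syndrome_def using sum.reindex_bij_betw[OF h, of "\<lambda>c. f c * M (g i) c"] M'[OF that]
    by simp
  have g1: "g i \<in> I" if "i \<in> I'" for i using g that by (auto simp: bij_betw_def)
  have g2: "\<exists>i'\<in>I'. i = g i'" if "i \<in> I" for i using g that by (auto simp: bij_betw_def)
  define k where "k = inv_into C' h"
  have hk: "h (k c) = c" "k c \<in> C'" if "c \<in> C" for c
    using h that unfolding k_def by (auto simp: bij_betw_def f_inv_into_f inv_into_into)
  have kh: "k (h c) = c" "h c \<in> C" if "c \<in> C'" for c
    using h that unfolding k_def by (auto simp: bij_betw_def)
  have w': "weight C (f \<circ> k) = weight C' f" for f :: "'d \<Rightarrow> 'a"
    using w[of "f \<circ> k"] weight_cong[of C' "f \<circ> k \<circ> h" f] kh by simp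
  have s': "syndrome M C (f \<circ> k) (g i) = syndrome M' C' f i" if "i \<in> I'" for f i
    using s[OF that, of "f \<circ> k"] syndrome_cong[of C' "f \<circ> k \<circ> h" f M' i] kh by simp
  show ?thesis
    unfolding covering_system_def
  proof (intro conjI allI ballI impI)
    fix v :: "'j \<Rightarrow> 'a"
    obtain f where "weight C f = R" "\<forall>i\<in>I. syndrome M C f i = v (inv_into I' g i)"
      using covering_systemD(1)[OF sys, of "\<lambda>i. v (inv_into I' g i)"] by blast
    then show "\<exists>f. weight C' f = R \<and> (\<forall>i\<in>I'. syndrome M' C' f i = v i)"
      using g g1 by (intro exI[of _ "f \<circ> h"]) (simp add: w s bij_betw_def)
  next
    fix c assume c: "c \<in> C'"
    obtain f0 where f0: "weight C f0 = R" "f0 (h c) \<noteq> 0"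
      and uniq: "\<forall>f. weight C f \<le> R \<longrightarrow> (\<forall>i\<in>I. syndrome M C f i = syndrome M C f0 i) \<longrightarrow>
        (\<forall>d\<in>C. f d = f0 d)"
      using covering_systemD(2)[OF sys kh(2)[OF c]] by (elim exE conjE)
    show "\<exists>f0. weight C' f0 = R \<and> f0 c \<noteq> 0 \<and>
        (\<forall>f. weight C' f \<le> R \<longrightarrow> (\<forall>i\<in>I'. syndrome M' C' f i = syndrome M' C' f0 i) \<longrightarrow>
          (\<forall>d\<in>C'. f d = f0 d))"
    proof (intro exI[of _ "f0 \<circ> h"] conjI allI impI ballI)
      fix f d
      assume "weight C' f \<le> R" and eq: "\<forall>i\<in>I'. syndrome M' C' f i = syndrome M' C' (f0 \<circ> h) i"
        and d: "d \<in> C'"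
      have "\<forall>d\<in>C. (f \<circ> k) d = f0 d"
      proof (rule uniq[THEN spec, THEN mp, THEN mp])
        show "weight C (f \<circ> k) \<le> R" using w' \<open>weight C' f \<le> R\<close> by simp
        show "\<forall>i\<in>I. syndrome M C (f \<circ> k) i = syndrome M C f0 i"
        proof
          fix i assume "i \<in> I"
          then obtain i' where i': "i' \<in> I'" "i = g i'" using g2 by blast
          show "syndrome M C (f \<circ> k) i = syndrome M C f0 i"
            using bspec[OF eq i'(1)] unfolding i'(2) s[OF i'(1)] s'[OF i'(1)] .
        qed
      qed
      from bspec[OF this kh(2)[OF d]] show "f d = (f0 \<circ> h) d" using kh(1)[OF d] by simp
    qed (use f0 w in simp_all)
  next
    fix f :: "'d \<Rightarrow> 'a"
    assume 0: "\<forall>i\<in>I'. syndrome M' C' f i = 0" and "\<exists>c\<in>C'. f c \<noteq> 0"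
    then obtain c where c: "c \<in> C'" "f c \<noteq> 0" by blast
    have "weight C (f \<circ> k) \<ge> 3"
    proof (rule covering_systemD(3)[OF sys])
      show "\<forall>i\<in>I. syndrome M C (f \<circ> k) i = 0"
      proof
        fix i assume "i \<in> I"
        then obtain i' where i': "i' \<in> I'" "i = g i'" using g2 by blast
        show "syndrome M C (f \<circ> k) i = 0" using bspec[OF 0 i'(1)] unfolding i'(2) s'[OF i'(1)] .
      qed
      show "\<exists>c\<in>C. (f \<circ> k) c \<noteq> 0" using kh[OF c(1)] c(2) by (intro bexI[of _ "h c"]) simp_all
    qed
    then show "3 \<le> weight C' f" by (simp add: w')
  next
    obtain f where "\<forall>i\<in>I. syndrome M C f i = 0" "weight C f = 3"
      using covering_systemD(4)[OF sys] by blast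
    then show "\<exists>f. (\<forall>i\<in>I'. syndrome M' C' f i = 0) \<and> weight C' f = 3"
      using g1 by (intro exI[of _ "f \<circ> h"]) (simp add: w s)
  qed
qed

lemma dim_column_comb [simp]: "dim_vec (column_comb H a J) = dim_row H"
proof -
  have "column_comb H a J \<in> carrier_vec (dim_row H)"
    unfolding column_comb_def by (rule finsum_vec_closed) auto
  then show ?thesis by simp
qed

lemma index_column_comb:
  assumes "J \<subseteq> {..<dim_col H}" "i < dim_row H"
  shows "column_comb H a J $ i = (\<Sum>j\<in>J. a j * H $$ (i, j))"
proof -
  have "finite J" using assms(1) by (rule finite_subset) simp
  then have "column_comb H a J $ i = (\<Sum>j\<in>J. (a j \<cdot>\<^sub>v col H j) $ i)"
    unfolding column_comb_def using assms by (intro index_finsum_vec) auto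
  also have "\<dots> = (\<Sum>j\<in>J. a j * H $$ (i, j))"
    using assms by (intro sum.cong) auto
  finally show ?thesis .
qed

section \<open>Code parameters of a matrix whose columns form a covering system\<close>

locale covering_matrix =
  fixes n r R :: nat and H :: "'a::field mat"
  assumes H: "H \<in> carrier_mat r n" and R: "R > 0"
    and sys: "covering_system {..<r} {..<n} (\<lambda>i j. H $$ (i, j)) R"
begin

abbreviation "syn \<equiv> syndrome (\<lambda>i j. H $$ (i, j)) {..<n}"

lemma column_comb_eq_syndrome:
  assumes "J \<subseteq> {..<n}" "i < r"
  shows "column_comb H a J $ i = syn (\<lambda>j. if j \<in> J then a j else 0) i"
proof -
  have "(\<Sum>j<n. (if j \<in> J then a j else 0) * H $$ (i, j)) = (\<Sum>j\<in>J. a j * H $$ (i, j))"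
    using assms by (intro sum.mono_neutral_cong_right) auto
  then show ?thesis using assms H by (simp add: index_column_comb syndrome_def)
qed

lemma weight_restrict_le:
  assumes "J \<subseteq> {..<n}"
  shows "weight {..<n} (\<lambda>j. if j \<in> J then a j else 0) \<le> card J"
  unfolding weight_def by (rule card_mono) (use assms in \<open>auto intro: finite_subset\<close>)

lemma surface_covering_H: "surface_covering H R"
  unfolding surface_covering_def
proof
  fix v :: "'a vec" assume v: "v \<in> carrier_vec (dim_row H)"
  obtain f where f: "weight {..<n} f = R" "\<forall>i\<in>{..<r}. syn f i = v $ i"
    using covering_systemD(1)[OF sys, of "\<lambda>i. v $ i"] by blast
  let ?J = "{j \<in> {..<n}. f j \<noteq> 0}"
  have "v = column_comb H f ?J"
  proof (rule eq_vecI)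
    fix i assume "i < dim_vec (column_comb H f ?J)"
    then have i: "i < r" using H by simp
    have "column_comb H f ?J $ i = syn (\<lambda>j. if j \<in> ?J then f j else 0) i"
      using i by (intro column_comb_eq_syndrome) auto
    also have "\<dots> = syn f i" by (rule syndrome_cong) auto
    finally show "v $ i = column_comb H f ?J $ i" using f i by simp
  qed (use v in simp)
  then show "\<exists>J a. J \<subseteq> {..<dim_col H} \<and> card J = R \<and> (\<forall>j\<in>J. a j \<noteq> 0) \<and> v = column_comb H a J"
    using f(1) H by (intro exI[of _ ?J] exI[of _ f]) (auto simp: weight_def)
qed

lemma covers_within_H: "covers_within H R"
  unfolding covers_within_def
proof
  fix v :: "'a vec" assume "v \<in> carrier_vec (dim_row H)"
  then obtain J a where "J \<subseteq> {..<dim_col H}" "card J = R" "v = column_comb H a J"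
    using surface_covering_H unfolding surface_covering_def by blast
  then show "\<exists>J a. J \<subseteq> {..<dim_col H} \<and> card J \<le> R \<and> v = column_comb H a J"
    by (intro exI[of _ J] exI[of _ a]) simp
qed

text \<open>The coefficients in \<open>column_comb\<close> are arbitrary outside \<open>J\<close>
  and may vanish on it, so words are compared after truncating \<open>a\<close> to
  \<open>J\<close>.\<close>

lemma unique_word:
  assumes "j < n"
  obtains f0 where "weight {..<n} f0 = R" "f0 j \<noteq> 0"
    "\<forall>J a. J \<subseteq> {..<n} \<longrightarrow> card J \<le> R \<longrightarrow> column_comb H a J = vec r (syn f0) \<longrightarrow>
      (\<forall>k<n. (if k \<in> J then a k else 0) = f0 k)"
proof -
  obtain f0 where f0: "weight {..<n} f0 = R" "f0 j \<noteq> 0"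
    and uniq: "\<forall>f. weight {..<n} f \<le> R \<longrightarrow> (\<forall>i\<in>{..<r}. syn f i = syn f0 i) \<longrightarrow>
      (\<forall>d\<in>{..<n}. f d = f0 d)"
    using covering_systemD(2)[OF sys, of j] assms by auto
  show thesis
  proof (rule that[OF f0], intro allI impI)
    fix J a k assume J: "J \<subseteq> {..<n}" "card J \<le> R" and eq: "column_comb H a J = vec r (syn f0)"
      and k: "k < n"
    have "\<forall>d\<in>{..<n}. (if d \<in> J then a d else 0) = f0 d"
    proof (rule uniq[THEN spec, THEN mp, THEN mp])
      show "weight {..<n} (\<lambda>j. if j \<in> J then a j else 0) \<le> R"
        using weight_restrict_le[OF J(1), of a] J(2) by simp
      show "\<forall>i\<in>{..<r}. syn (\<lambda>j. if j \<in> J then a j else 0) i = syn f0 i"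
        using column_comb_eq_syndrome[OF J(1), of _ a] eq by auto
    qed
    then show "(if k \<in> J then a k else 0) = f0 k" using k by simp
  qed
qed

lemma n_pos: "n > 0"
proof -
  obtain f :: "nat \<Rightarrow> 'a" where "weight {..<n} f = R" using covering_systemD(1)[OF sys] by blast
  then show ?thesis using R by (auto simp: weight_def intro: Nat.gr0I)
qed

text \<open>The syndrome of a unique word has no representation with fewer columns, since that word
  has weight \<open>R\<close>.\<close>

lemma not_covers_within: "covers_within H \<rho> \<Longrightarrow> R \<le> \<rho>"
proof (rule ccontr)
  assume cov: "covers_within H \<rho>" and "\<not> R \<le> \<rho>"
  then have less: "\<rho> < R" by simp
  obtain f0 where f0: "weight {..<n} f0 = R" "f0 0 \<noteq> 0" and uniq: "\<forall>J a. J \<subseteq> {..<n} \<longrightarrow> card J \<le> R \<longrightarrow>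
      column_comb H a J = vec r (syn f0) \<longrightarrow> (\<forall>k<n. (if k \<in> J then a k else 0) = f0 k)"
    by (rule unique_word[OF n_pos])
  have "vec r (syn f0) \<in> carrier_vec (dim_row H)" using H by simp
  then obtain J a where J: "J \<subseteq> {..<n}" "card J \<le> \<rho>" "vec r (syn f0) = column_comb H a J"
    using cov H unfolding covers_within_def by (metis carrier_matD(2))
  then have "\<forall>k<n. (if k \<in> J then a k else 0) = f0 k"
    using uniq less by (metis less_imp_le_nat le_trans)
  then have "weight {..<n} f0 \<le> card J"
    using weight_restrict_le[OF J(1), of a] weight_cong[of "{..<n}" f0 "\<lambda>k. if k \<in> J then a k else 0"]
    by simp
  then show False using f0 J less by simp
qed

lemma covering_radius_H: "covering_radius H = enat R"
  unfolding covering_radius_def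
proof (rule antisym)
  show "Inf (enat ` {\<rho>. covers_within H \<rho>}) \<le> enat R"
    using covers_within_H by (intro Inf_lower) simp
  show "enat R \<le> Inf (enat ` {\<rho>. covers_within H \<rho>})"
    by (rule Inf_greatest) (auto dest: not_covers_within)
qed

text \<open>A representation with at most \<open>R\<close> columns avoiding \<open>j\<close> would
  have to be the unique word through \<open>j\<close>, which is nonzero there.\<close>

lemma not_covers_within_delete_column:
  assumes j: "j < n" and cov: "covers_within (delete_column H j) \<rho>"
  shows "R < \<rho>"
proof (rule ccontr)
  assume "\<not> R < \<rho>"
  obtain f0 where f0: "weight {..<n} f0 = R" "f0 j \<noteq> 0" and uniq: "\<forall>J a. J \<subseteq> {..<n} \<longrightarrow> card J \<le> R \<longrightarrow>
      column_comb H a J = vec r (syn f0) \<longrightarrow> (\<forall>k<n. (if k \<in> J then a k else 0) = f0 k)"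
    by (rule unique_word[OF j])
  let ?D = "delete_column H j"
  have D: "dim_row ?D = r" "dim_col ?D = n - 1" using H by (simp_all add: delete_column_def)
  have "vec r (syn f0) \<in> carrier_vec (dim_row ?D)" using D by simp
  then obtain J a where J: "J \<subseteq> {..<n - 1}" "card J \<le> \<rho>" "vec r (syn f0) = column_comb ?D a J"
    using cov D unfolding covers_within_def by metis
  define up where "up k = (if k < j then k else Suc k)" for k
  define down where "down k = (if k < j then k else k - 1)" for k
  have du: "down (up k) = k" for k by (simp add: up_def down_def)
  then have inj: "inj_on up J" by (metis inj_onI)
  have "column_comb H (a \<circ> down) (up ` J) = vec r (syn f0)"
  proof (rule eq_vecI)
    fix i assume "i < dim_vec (vec r (syn f0))"
    then have i: "i < r" by simp
    have "up ` J \<subseteq> {..<n}" using J(1) by (auto simp: up_def)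
    then have "column_comb H (a \<circ> down) (up ` J) $ i = (\<Sum>k\<in>up ` J. (a \<circ> down) k * H $$ (i, k))"
      using H i by (simp add: index_column_comb)
    also have "\<dots> = (\<Sum>k\<in>J. a k * H $$ (i, up k))" by (simp add: sum.reindex[OF inj] du)
    also have "\<dots> = (\<Sum>k\<in>J. a k * ?D $$ (i, k))"
      using J(1) i H by (intro sum.cong) (auto simp: delete_column_def up_def)
    also have "\<dots> = column_comb ?D a J $ i" using J(1) D i by (simp add: index_column_comb)
    finally show "column_comb H (a \<circ> down) (up ` J) $ i = vec r (syn f0) $ i" by (simp add: J(3))
  qed (use H in simp)
  moreover have "up ` J \<subseteq> {..<n}" using J(1) by (auto simp: up_def)
  moreover have "card (up ` J) \<le> R" using J(2) \<open>\<not> R < \<rho>\<close> by (simp add: card_image[OF inj])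
  ultimately have "(if j \<in> up ` J then (a \<circ> down) j else 0) = f0 j" using uniq j by blast
  moreover have "j \<notin> up ` J" by (auto simp: up_def split: if_splits)
  ultimately show False using f0 by simp
qed

lemma locally_optimal_H: "locally_optimal H"
  unfolding locally_optimal_def
proof (intro allI impI)
  fix j assume "j < dim_col H"
  then have j: "j < n" using H by simp
  \<comment> \<open>As a lower bound of the infimum this also covers the infinite radius of a matrix
    whose remaining columns do not span.\<close>
  have "enat (Suc R) \<le> covering_radius (delete_column H j)"
    unfolding covering_radius_def
    by (rule Inf_greatest) (use not_covers_within_delete_column[OF j] in \<open>auto simp: Suc_le_eq\<close>)
  then show "covering_radius H < covering_radius (delete_column H j)"
    unfolding covering_radius_H by (metis enat_ord_simps(2) lessI less_le_trans)
qed

lemma mult_mat_vec_eq_syndrome: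
  "x \<in> carrier_vec n \<Longrightarrow> i < r \<Longrightarrow> (H *\<^sub>v x) $ i = syn (\<lambda>j. x $ j) i"
  using H by (simp add: syndrome_def scalar_prod_def mult.commute lessThan_atLeast0)

lemma mem_mat_kernel_iff:
  "x \<in> mat_kernel H \<longleftrightarrow> x \<in> carrier_vec n \<and> (\<forall>i<r. syn (\<lambda>j. x $ j) i = 0)"
proof -
  have "H *\<^sub>v x = 0\<^sub>v r \<longleftrightarrow> (\<forall>i<r. syn (\<lambda>j. x $ j) i = 0)" if "x \<in> carrier_vec n"
    using that H mult_mat_vec_eq_syndrome[OF that] by (auto simp: vec_eq_iff)
  then show ?thesis unfolding mat_kernel[OF H] by auto
qed

lemma min_distance_H: "min_distance (mat_kernel H) = 3"
  unfolding min_distance_def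
proof (rule cInf_eq_minimum)
  obtain f where f: "\<forall>i\<in>{..<r}. syn f i = 0" "weight {..<n} f = 3"
    using covering_systemD(4)[OF sys] by blast
  have "syn (\<lambda>j. vec n f $ j) i = syn f i" for i by (rule syndrome_cong) simp
  then have 1: "vec n f \<in> mat_kernel H" using f by (simp add: mem_mat_kernel_iff)
  have "syn (\<lambda>j. 0\<^sub>v n $ j) i = 0" for i by (simp add: syndrome_def)
  then have 2: "0\<^sub>v n \<in> mat_kernel H" by (simp add: mem_mat_kernel_iff)
  have 3: "hamming_dist (vec n f) (0\<^sub>v n) = 3"
  proof -
    have "{i. i < dim_vec (vec n f) \<and> vec n f $ i \<noteq> 0\<^sub>v n $ i} = {c \<in> {..<n}. f c \<noteq> 0}" by auto
    then show ?thesis using f(2) unfolding hamming_dist_def weight_def by simp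
  qed
  then have "vec n f \<noteq> 0\<^sub>v n" by (auto simp: hamming_dist_def)
  with 1 2 3 show "3 \<in> {hamming_dist x y |x y. x \<in> mat_kernel H \<and> y \<in> mat_kernel H \<and> x \<noteq> y}"
    by (metis (mono_tags, lifting) mem_Collect_eq)
next
  fix d assume "d \<in> {hamming_dist x y |x y. x \<in> mat_kernel H \<and> y \<in> mat_kernel H \<and> x \<noteq> y}"
  then obtain x y where d: "d = hamming_dist x y" and xy: "x \<in> mat_kernel H" "y \<in> mat_kernel H" "x \<noteq> y"
    by blast
  then have c: "x \<in> carrier_vec n" "y \<in> carrier_vec n" by (simp_all add: mem_mat_kernel_iff)
  let ?f = "\<lambda>j. x $ j - y $ j"
  have "weight {..<n} ?f \<ge> 3"
  proof (rule covering_systemD(3)[OF sys])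
    have "syn ?f i = syn (\<lambda>j. x $ j) i - syn (\<lambda>j. y $ j) i" for i
      by (simp add: syndrome_def left_diff_distrib sum_subtractf)
    then show "\<forall>i\<in>{..<r}. syn ?f i = 0" using xy by (simp add: mem_mat_kernel_iff)
    show "\<exists>c\<in>{..<n}. ?f c \<noteq> 0"
      using xy(3) c by (auto simp: vec_eq_iff)
  qed
  moreover have "{i. i < dim_vec x \<and> x $ i \<noteq> y $ i} = {c \<in> {..<n}. ?f c \<noteq> 0}" using c by auto
  ultimately show "3 \<le> d" unfolding d hamming_dist_def weight_def by simp
qed

lemma image_mult_mat_vec: "(\<lambda>x. H *\<^sub>v x) ` carrier_vec n = carrier_vec r"
proof (intro antisym subsetI)
  fix v :: "'a vec" assume v: "v \<in> carrier_vec r"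
  obtain f where f: "\<forall>i\<in>{..<r}. syn f i = v $ i"
    using covering_systemD(1)[OF sys, of "\<lambda>i. v $ i"] by blast
  have "H *\<^sub>v vec n f = v"
  proof (rule eq_vecI)
    fix i assume "i < dim_vec v"
    then have i: "i < r" using v by simp
    have "(H *\<^sub>v vec n f) $ i = syn (\<lambda>j. vec n f $ j) i"
      using i by (intro mult_mat_vec_eq_syndrome) simp
    also have "\<dots> = syn f i" by (rule syndrome_cong) simp
    finally show "(H *\<^sub>v vec n f) $ i = v $ i" using f i by simp
  qed (use H v in simp)
  then show "v \<in> (\<lambda>x. H *\<^sub>v x) ` carrier_vec n" by (intro image_eqI[of _ _ "vec n f"]) simp_all
qed (use H in auto)

lemma rank_H: "vec_space.rank r H = r"
proof -
  interpret W: vec_space "TYPE('a)" r .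
  have "W.col_space H = (\<lambda>x. H *\<^sub>v x) ` carrier_vec n"
    unfolding W.col_space_eq[OF H] using H by auto
  then have "W.col_space H = carrier_vec r" by (simp add: image_mult_mat_vec)
  then have span: "W.span (set (cols H)) = carrier_vec r" by (simp add: W.col_space_def)
  have self: "W.V\<lparr>carrier := carrier_vec r\<rparr> = W.V" by (simp add: module_vec_def)
  have "W.rank H = W.dim" unfolding W.rank_def span by (simp only: self)
  then show ?thesis by (simp add: W.dim_is_n)
qed

lemma linear_code_H: "linear_code n (n - r) (mat_kernel H)"
proof -
  interpret V: vec_space "TYPE('a)" n .
  interpret W: vec_space "TYPE('a)" r .
  interpret T: linear_map class_ring V.V W.V "\<lambda>x. H *\<^sub>v x"
  proof
    show "(\<lambda>x. H *\<^sub>v x) \<in> module_hom class_ring V.V W.V"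
      using H by (auto simp: module_hom_def mult_add_distrib_mat_vec[OF H] mult_mat_vec[OF H])
  qed
  have ker: "T.kerT = mat_kernel H"
    unfolding T.ker_def using mat_kernel[OF H] by auto
  have im: "T.imT = carrier_vec r"
    unfolding T.im_def using image_mult_mat_vec by simp
  have self: "W.V\<lparr>carrier := carrier_vec r\<rparr> = W.V" by (simp add: module_vec_def)
  have "W.dim + vectorspace.dim class_ring (V.V\<lparr>carrier := mat_kernel H\<rparr>) = V.dim"
    using T.rank_nullity[OF V.fin_dim] unfolding ker im by (simp only: self)
  then have "vectorspace.dim class_ring (V.V\<lparr>carrier := mat_kernel H\<rparr>) = n - r"
    unfolding V.dim_is_n W.dim_is_n by simp
  then show ?thesis
    unfolding linear_code_def using T.kerT_is_subspace unfolding ker by simp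
qed

lemma surface_covering_code_H: "surface_covering_code n r 3 R (mat_kernel H) H"
  unfolding surface_covering_code_def parity_check_matrix_def
  using linear_code_H min_distance_H rank_H covering_radius_H surface_covering_H H by simp

end

lemma covering_system_imp_code:
  fixes M :: "'i \<Rightarrow> 'c \<Rightarrow> 'a::field"
  assumes "finite I" "finite C" and R: "R > 0" and sys: "covering_system I C M R"
  shows "\<exists>(K :: 'a vec set) H. surface_covering_code (card C) (card I) 3 R K H \<and> locally_optimal H"
proof -
  obtain g where g: "bij_betw g {..<card I} I"
    using ex_bij_betw_nat_finite[OF assms(1)] by (auto simp: atLeast0LessThan)
  obtain h where h: "bij_betw h {..<card C} C"
    using ex_bij_betw_nat_finite[OF assms(2)] by (auto simp: atLeast0LessThan)
  let ?H = "mat (card I) (card C) (\<lambda>(i, j). M (g i) (h j))"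
  have "covering_system {..<card I} {..<card C} (\<lambda>i j. ?H $$ (i, j)) R"
    by (rule covering_system_reindex[OF g h sys]) simp
  then interpret covering_matrix "card C" "card I" R ?H
    by unfold_locales (use R in auto)
  show ?thesis using surface_covering_code_H locally_optimal_H by blast
qed

text \<open>Each base column \<open>c\<close> receives its own point \<open>\<iota> c\<close> of the
  projective line over \<open>K\<close>, which the bound on \<open>card C\<close> permits. The
  \<open>R\<close> products of x with the entries of \<open>proj_power R (\<iota> c)\<close> have
  \<open>m\<close> coordinates each. If two choices of positions give equal sums, the quantities
  \<open>to_ac (a j) * (x j - x' j)\<close> solve a homogeneous Vandermonde system and
  vanish.\<close>

lemma field_lift:
  fixes C :: "'c set"
  assumes q: "primepow (CARD('a::{field,finite}))" and m: "m > 0"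
    and C: "finite C" "card C \<le> CARD('a::{field,finite}) ^ m + 1"
  shows "\<exists>(U :: 'a::{field,finite} alg_closure set) (S :: ('a::{field,finite} alg_closure \<times> nat) set)
    (L :: 'c \<Rightarrow> 'a alg_closure \<Rightarrow> 'a alg_closure \<times> nat \<Rightarrow> 'a).
    finite U \<and> finite S \<and> card U = CARD('a) ^ m \<and> card S = m * R \<and> 0 \<in> U \<and>
    (\<forall>c s. L c 0 s = 0) \<and>
    (\<forall>J a x x'. J \<subseteq> C \<longrightarrow> card J = R \<longrightarrow> (\<forall>j\<in>J. a j \<noteq> 0) \<longrightarrow> (\<forall>j\<in>J. x j \<in> U) \<longrightarrow>
      (\<forall>j\<in>J. x' j \<in> U) \<longrightarrow>
      (\<forall>s\<in>S. (\<Sum>j\<in>J. a j * L j (x j) s) = (\<Sum>j\<in>J. a j * L j (x' j) s)) \<longrightarrow>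
      (\<forall>j\<in>J. x j = x' j))"
proof -
  let ?Q = "CARD('a) ^ m"
  define K :: "'a alg_closure set" where "K = subfield_of_order ?Q"
  have cardK: "card K = ?Q" unfolding K_def by (rule card_subfield_of_order[OF q m])
  then have finK: "finite K" by (intro card_ge_0_finite) simp
  have K0: "0 \<in> K" by (simp add: K_def subfield_of_order_def)
  have K_mult: "x * y \<in> K" if "x \<in> K" "y \<in> K" for x y
    using that by (simp add: K_def subfield_of_order_def power_mult_distrib)
  have K1: "1 \<in> K" by (simp add: K_def subfield_of_order_def)
  have K_power: "x ^ i \<in> K" if "x \<in> K" for x i
    using that K1 by (induction i) (auto intro: K_mult)
  obtain B :: "'a alg_closure set" and r where B: "finite B" "card B = m"
    and r0: "r 0 = (\<lambda>_. 0)"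
    and r_sum: "\<forall>(J :: 'c set) a x. (\<forall>j\<in>J. x j \<in> K) \<longrightarrow>
      (\<Sum>j\<in>J. to_ac (a j) * x j) \<in> K \<and>
      r (\<Sum>j\<in>J. to_ac (a j) * x j) = (\<lambda>b. \<Sum>j\<in>J. a j * r (x j) b)"
    and r_inj: "\<forall>u\<in>K. \<forall>v\<in>K. (\<forall>b\<in>B. r u b = r v b) \<longrightarrow> u = v"
    using ex_coordinates[OF q m K_def] by (elim exE conjE)
  have K_sum: "(\<Sum>j\<in>J. to_ac (a j) * x j) \<in> K" if "\<forall>j\<in>J. x j \<in> K" for J :: "'c set" and a x
    using r_sum that by blast
  have "card (insert None (Some ` K)) = ?Q + 1"
    using finK cardK by (simp add: card_image)
  then have "card C \<le> card (insert None (Some ` K))" using C by simp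
  then obtain \<iota> where \<iota>: "\<iota> ` C \<subseteq> insert None (Some ` K)" "inj_on \<iota> C"
    using card_le_inj[OF C(1), of "insert None (Some ` K)"] finK by auto
  have node: "proj_power R (\<iota> c) i \<in> K" if "c \<in> C" for c i
    using \<iota>(1) that K0 K1 K_power by (auto simp: proj_power_def image_subset_iff)
  define L where "L c x = (\<lambda>(b, i). r (x * proj_power R (\<iota> c) i) b)" for c x
  let ?S = "B \<times> {..<R}"
  have inj: "\<forall>j\<in>J. x j = x' j"
    if J: "J \<subseteq> C" "card J = R" and a: "\<forall>j\<in>J. a j \<noteq> 0" and x: "\<forall>j\<in>J. x j \<in> K" "\<forall>j\<in>J. x' j \<in> K"
      and eq: "\<forall>s\<in>?S. (\<Sum>j\<in>J. a j * L j (x j) s) = (\<Sum>j\<in>J. a j * L j (x' j) s)"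
    for J a x x'
  proof
    fix k assume k: "k \<in> J"
    let ?u = "\<lambda>x i. \<Sum>j\<in>J. to_ac (a j) * (x j * proj_power R (\<iota> j) i)"
    have mem: "\<forall>j\<in>J. y j * proj_power R (\<iota> j) i \<in> K" if "\<forall>j\<in>J. y j \<in> K" for y i
      using that J(1) by (auto intro!: K_mult node)
    have "?u x i = ?u x' i" if i: "i < R" for i
    proof (rule r_inj[rule_format])
      show "?u x i \<in> K" "?u x' i \<in> K" using mem x by (intro K_sum; blast)+
      fix b assume b: "b \<in> B"
      have "r (?u y i) b = (\<Sum>j\<in>J. a j * L j (y j) (b, i))" if "\<forall>j\<in>J. y j \<in> K" for y
        using r_sum[rule_format, of J "\<lambda>j. y j * proj_power R (\<iota> j) i" a] mem[OF that, of i]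
        by (simp add: L_def)
      then show "r (?u x i) b = r (?u x' i) b" using x eq b i by simp
    qed
    then have "(\<Sum>j\<in>J. to_ac (a j) * (x j - x' j) * proj_power R (\<iota> j) i) = 0" if "i < R" for i
      using that by (simp add: algebra_simps sum_subtractf)
    moreover have "finite J" "inj_on \<iota> J" using J C \<iota>(2) by (auto intro: finite_subset inj_on_subset)
    ultimately have "to_ac (a k) * (x k - x' k) = 0"
      using projective_vandermonde[of J R \<iota> "\<lambda>j. to_ac (a j) * (x j - x' j)" k] J(2) k by blast
    then show "x k = x' k" using a k by simp
  qed
  have "card ?S = m * R" using B by (simp add: card_cartesian_product)
  moreover have "L c 0 s = 0" for c s by (cases s) (simp add: L_def r0)
  ultimately show ?thesis
    using finK cardK K0 B(1) inj by (intro exI[of _ K] exI[of _ ?S] exI[of _ L]) simp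
qed

section \<open>Assembly of the code and its length\<close>

lemma ex_covering_system:
  assumes q: "primepow (CARD('a::{field,finite}))" and card: "CARD('a::{field,finite}) \<ge> 7"
    and two: "(2::'a::{field,finite}) \<noteq> 0" and R: "R \<ge> 3"
    and m: "m = 0 \<or> R * CARD('a::{field,finite}) \<le> CARD('a::{field,finite}) ^ m"
  shows "\<exists>(I :: (nat \<times> bool + 'a::{field,finite} alg_closure \<times> nat) set)
    (C :: ((nat \<times> 'a) option \<times> 'a alg_closure) set) (M :: _ \<Rightarrow> _ \<Rightarrow> 'a).
    finite I \<and> finite C \<and> card I = (m + 2) * R \<and> card C = (R * CARD('a) + 1) * CARD('a) ^ m \<and>
    covering_system I C M R"
proof -
  let ?C = "base_columns R :: (nat \<times> 'a) option set"
  have cardC: "card ?C = R * CARD('a) + 1" by (rule card_base_columns)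
  have "R * 1 \<le> R * CARD('a)" using card by (intro mult_le_mono) auto
  then have CR: "R \<le> card ?C" unfolding cardC by linarith
  obtain U :: "'a alg_closure set" and S :: "('a alg_closure \<times> nat) set"
    and L :: "(nat \<times> 'a) option \<Rightarrow> 'a alg_closure \<Rightarrow> 'a alg_closure \<times> nat \<Rightarrow> 'a"
    where U: "finite U" "finite S" "card U = CARD('a) ^ m" "card S = m * R" "0 \<in> U"
    and L0: "\<forall>c s. L c 0 s = 0"
    and inj: "\<forall>J a x x'. J \<subseteq> ?C \<longrightarrow> card J = R \<longrightarrow> (\<forall>j\<in>J. a j \<noteq> 0) \<longrightarrow> (\<forall>j\<in>J. x j \<in> U) \<longrightarrow>
      (\<forall>j\<in>J. x' j \<in> U) \<longrightarrow>
      (\<forall>s\<in>S. (\<Sum>j\<in>J. a j * L j (x j) s) = (\<Sum>j\<in>J. a j * L j (x' j) s)) \<longrightarrow>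
      (\<forall>j\<in>J. x j = x' j)"
  proof (cases "m = 0")
    case True
    \<comment> \<open>One position and no new rows leave the base system unchanged up to
      relabelling; this is the case \<open>t = 2\<close>.\<close>
    show thesis by (rule that[of "{0}" "{}" "\<lambda>_ _ _. 0"]) (use True in auto)
  next
    case False
    \<comment> \<open>The \<open>R * CARD('a) + 1\<close> base columns must fit into the
      \<open>CARD('a) ^ m + 1\<close> points of the projective line.\<close>
    then have "m > 0" "card ?C \<le> CARD('a) ^ m + 1" using m cardC by simp_all
    from field_lift[OF q this(1) finite_base_columns this(2), of R] show thesis
      by (elim exE conjE) (rule that)
  qed
  have "covering_system (({..<R} \<times> UNIV) <+> S) (?C \<times> U) (lifted_entry (base_entry R) L) R"
  proof (rule lift_covering_system[where z = 0])
    show "covering_system ({..<R} \<times> UNIV) ?C (base_entry R) R"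
      by (rule base_covering_system[OF card two R])
    show "card U ^ R = CARD('a) ^ card S" using U by (simp add: power_mult)
    fix J a x x'
    assume *: "J \<subseteq> ?C" "card J = R" "\<And>j. j \<in> J \<Longrightarrow> a j \<noteq> 0" "\<And>j. j \<in> J \<Longrightarrow> x j \<in> U"
      "\<And>j. j \<in> J \<Longrightarrow> x' j \<in> U"
      "\<And>s. s \<in> S \<Longrightarrow> (\<Sum>j\<in>J. a j * L j (x j) s) = (\<Sum>j\<in>J. a j * L j (x' j) s)"
    show "\<forall>j\<in>J. x j = x' j"
    proof
      fix j assume "j \<in> J"
      then show "x j = x' j" by (intro inj[rule_format, of J a x x' j] *)
    qed
  next
    show "L c 0 s = 0" for c s using L0 by blast
  qed (use CR R U in simp_all)
  moreover have "card (({..<R} \<times> (UNIV :: bool set)) <+> S) = (m + 2) * R"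
    using U by (simp add: card_Plus card_cartesian_product algebra_simps)
  moreover have "card (?C \<times> U) = (R * CARD('a) + 1) * CARD('a) ^ m"
    using U cardC by (simp add: card_cartesian_product)
  moreover have "finite (({..<R} \<times> (UNIV :: bool set)) <+> S)" "finite (?C \<times> U)"
    using U by simp_all
  ultimately show ?thesis by blast
qed

theorem theorem5p1:
  fixes q R t r n :: nat
  assumes "CARD('a :: {field, finite}) = q"
    and "primepow q" and "odd q" and "q \<ge> 7"
    and "R \<ge> 4"
    and "t = 2 \<or> int t \<ge> \<lceil>log (real q) (real R)\<rceil> + 3"
    and "r = t * R"
    and "n = R * q ^ ((r - R) div R) + q ^ ((r - 2 * R) div R)"
  shows "\<exists>(C :: 'a vec set) H. surface_covering_code n r 3 R C H \<and> locally_optimal H"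
proof -
  have two: "(2::'a) \<noteq> 0"
  proof
    assume "(2::'a) = 0"
    then have "of_nat 2 = (0::'a)" by simp
    then have "CHAR('a) dvd 2" by (simp only: of_nat_eq_0_iff_char_dvd)
    moreover have "Factorial_Ring.prime CHAR('a)"
      using card_field_eq_CHAR_power(1)[where ?'a = 'a] assms(1,2) by simp
    ultimately have "CHAR('a) = 2" using primes_dvd_imp_eq two_is_prime_nat by blast
    then show False using CHAR_dvd_CARD[where ?'a = 'a] assms(1,3) by simp
  qed
  \<comment> \<open>The bound on \<open>t\<close> says \<open>R \<le> q ^ (t - 3)\<close>;
    multiplied by \<open>q\<close> this leaves enough distinct nodes for the lift.\<close>
  have t: "t \<ge> 2 \<and> (t = 2 \<or> R * q \<le> q ^ (t - 2))"
  proof (cases "t = 2")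
    case False
    then have ceil: "int t \<ge> \<lceil>log (real q) (real R)\<rceil> + 3" using assms(6) by simp
    have q1: "real q > 1" and R0: "real R > 0" using assms(4,5) by simp_all
    \<comment> \<open>\<open>R > 1\<close> makes the logarithm positive, so \<open>t - 3\<close>
      below is a genuine difference.\<close>
    have "log (real q) (real R) > 0" using q1 assms(5) by simp
    then have t3: "t > 3" using ceil by linarith
    have "log (real q) (real R) \<le> real (t - 3)" using ceil t3 by linarith
    then have "real R \<le> real q powr real (t - 3)" using q1 R0 by (simp add: log_le_iff)
    also have "\<dots> = real (q ^ (t - 3))" using q1 by (simp add: powr_realpow)
    finally have "R \<le> q ^ (t - 3)" by linarith
    then have "R * q \<le> q ^ Suc (t - 3)" by simp
    also have "Suc (t - 3) = t - 2" using t3 by simp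
    finally show ?thesis using t3 by simp
  qed simp
  \<comment> \<open>The extension degree of the lift: \<open>m * R\<close> new rows join the
    \<open>2 * R\<close> rows of the base code.\<close>
  define m where "m = t - 2"
  have tm: "t = m + 2" using conjunct1[OF t] unfolding m_def by linarith
  have "(r - R) div R = Suc m" "(r - 2 * R) div R = m"
    using assms(5) unfolding assms(7) tm by (simp_all add: algebra_simps)
  then have n: "n = (R * CARD('a) + 1) * CARD('a) ^ m"
    unfolding assms(8) assms(1) by (simp add: algebra_simps)
  have "m = 0 \<or> R * CARD('a) \<le> CARD('a) ^ m" using t assms(1) by (auto simp: m_def)
  moreover have "primepow CARD('a)" "CARD('a) \<ge> 7" "R \<ge> 3" using assms by simp_all
  ultimately obtain I :: "(nat \<times> bool + 'a alg_closure \<times> nat) set"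
    and C :: "((nat \<times> 'a) option \<times> 'a alg_closure) set" and M :: "_ \<Rightarrow> _ \<Rightarrow> 'a"
    where "finite I" "finite C" "card I = (m + 2) * R" "card C = (R * CARD('a) + 1) * CARD('a) ^ m"
      "covering_system I C M R"
    using ex_covering_system[where ?'a = 'a, of R m] two by blast
  then show ?thesis
    using covering_system_imp_code[of I C R M] assms(5,7) n tm by simp
qed

end
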